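(* Let $n\in\mathbb{N}$ and let $A,B\in\mathbb{M}_n^+$ with $B>0$. (1) For $0<\alpha<1$ and $z>0$, $P_\alpha(A,B)\prec_{\log}Q_{\alpha,z}(A,B)$. (2) For $\alpha>1$ and $0<z\le\min\{\alpha/2,\alpha-1\}$, $P_\alpha(A,B)\prec_{\log}Q_{\alpha,z}(A,B)$. (3) For $\alpha>1$ and $z\ge\max\{\alpha/2,\alpha-1\}$, $Q_{\alpha,z}(A,B)\prec_{\log}P_\alpha(A,B)$. In particular, $P_\alpha(A,B)\prec_{\log}Q_\alpha(A,B)$ if $0<\alpha<1$ or $\alpha\ge2$, and $Q_\alpha(A,B)\prec_{\log}P_\alpha(A,B)$ if $1<\alpha\le2$.
   Context: $\mathbb{M}_n$ is the set of $n\times n$ complex matrices, $\mathbb{M}_n^+$ the set of positive semidefinite ones, and $B>0$ means that $B$ is positive definite. For $\alpha,z>0$ with $\alpha\ne1$ and $A,B\in\mathbb{M}_n^+$ with $B>0$, $$P_\alpha(A,B):=B^{1/2}(B^{-1/2}AB^{-1/2})^\alpha B^{1/2},\qquad Q_{\alpha,z}(A,B):=\bigl(B^{\frac{1-\alpha}{2z}}A^{\frac{\alpha}{z}}B^{\frac{1-\alpha}{2z}}\bigr)^z,$$ and $Q_\alpha(A,B):=Q_{\alpha,1}(A,B)=B^{\frac{1-\alpha}{2}}A^\alpha B^{\frac{1-\alpha}{2}}$. For $X,Y\in\mathbb{M}_n^+$, with eigenvalues listed in decreasing order with multiplicity, $\lambda_1(X)\ge\dots\ge\lambda_n(X)$ and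 similarly for $Y$, the log-majorization $X\prec_{\log}Y$ means $\prod_{i=1}^k\lambda_i(X)\le\prod_{i=1}^k\lambda_i(Y)$ for $k=1,\dots,n$, with equality for $k=n$. *)

theory Defs
  imports
    "HOL-Library.Multiset"
    "HOL-Computational_Algebra.Polynomial"
    "Jordan_Normal_Form.Char_Poly"
    "Jordan_Normal_Form.Schur_Decomposition"
begin

text \<open>On \<^typ>\<open>complex\<close>, \<open>0 \<le> c\<close> and \<open>0 < c\<close> say that \<open>c\<close> is real and nonnegative, respectively
  positive. \<open>(A *\<^sub>v v) \<bullet>c v\<close> is the quadratic form of \<open>A\<close> at \<open>v\<close>.\<close>

definition psd :: "nat \<Rightarrow> complex mat \<Rightarrow> bool" where
  "psd n A \<longleftrightarrow> A \<in> carrier_mat n n \<and> mat_adjoint A = A \<and>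
     (\<forall>v \<in> carrier_vec n. 0 \<le> (A *\<^sub>v v) \<bullet>c v)"

definition pd :: "nat \<Rightarrow> complex mat \<Rightarrow> bool" where
  "pd n A \<longleftrightarrow> A \<in> carrier_mat n n \<and> mat_adjoint A = A \<and>
     (\<forall>v \<in> carrier_vec n. v \<noteq> 0\<^sub>v n \<longrightarrow> 0 < (A *\<^sub>v v) \<bullet>c v)"

definition unitary :: "nat \<Rightarrow> complex mat \<Rightarrow> bool" where
  "unitary n U \<longleftrightarrow> U \<in> carrier_mat n n \<and> mat_adjoint U * U = 1\<^sub>m n"

text \<open>Real powers by functional calculus: if \<open>A = U diag(d) U\<^sup>*\<close> with \<open>U\<close> unitary and \<open>d\<close> real, then
  \<open>A\<^sup>p = U diag(d\<^sup>p) U\<^sup>*\<close>. For Hermitian \<open>A\<close> such a diagonalization exists, and the result does not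
  depend on the one chosen. Since \<open>0 powr p = 0\<close>, the convention for singular positive
  semidefinite \<open>A\<close> and \<open>p > 0\<close> is the usual one.\<close>

definition mat_powr :: "complex mat \<Rightarrow> real \<Rightarrow> complex mat" (infixr "powm" 80) where
  "A powm p = (THE X. \<exists>U (d :: nat \<Rightarrow> real).
     unitary (dim_row A) U \<and>
     A = U * mat_diag (dim_row A) (\<lambda>i. complex_of_real (d i)) * mat_adjoint U \<and>
     X = U * mat_diag (dim_row A) (\<lambda>i. complex_of_real (d i powr p)) * mat_adjoint U)"

definition P_alpha :: "real \<Rightarrow> complex mat \<Rightarrow> complex mat \<Rightarrow> complex mat" where
  "P_alpha \<alpha> A B = B powm (1/2) * ((B powm (-1/2) * A * B powm (-1/2)) powm \<alpha>) * B powm (1/2)"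

definition Q_alpha_z :: "real \<Rightarrow> real \<Rightarrow> complex mat \<Rightarrow> complex mat \<Rightarrow> complex mat" where
  "Q_alpha_z \<alpha> z A B =
     (B powm ((1 - \<alpha>) / (2 * z)) * A powm (\<alpha> / z) * B powm ((1 - \<alpha>) / (2 * z))) powm z"

definition Q_alpha :: "real \<Rightarrow> complex mat \<Rightarrow> complex mat \<Rightarrow> complex mat" where
  "Q_alpha \<alpha> A B = Q_alpha_z \<alpha> 1 A B"

text \<open>Eigenvalues in decreasing order, repeated according to multiplicity as roots of the
  characteristic polynomial. Taking real parts is harmless, because this is only used for
  Hermitian matrices. The list index starts at \<open>0\<close>.\<close>

definition eigvals_desc :: "complex mat \<Rightarrow> real list" where
  "eigvals_desc X = rev (sorted_list_of_multiset (image_mset Re (proots (char_poly X))))"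

text \<open>Log-majorization is a relation on positive semidefinite matrices, so membership in that set
  is part of it.\<close>

definition log_maj :: "nat \<Rightarrow> complex mat \<Rightarrow> complex mat \<Rightarrow> bool" where
  "log_maj n X Y \<longleftrightarrow> psd n X \<and> psd n Y \<and>
     (\<forall>k \<in> {1..n}. (\<Prod>i<k. eigvals_desc X ! i) \<le> (\<Prod>i<k. eigvals_desc Y ! i)) \<and>
     (\<Prod>i<n. eigvals_desc X ! i) = (\<Prod>i<n. eigvals_desc Y ! i)"

end

theory Submission
  imports Defs "HOL-Analysis.Elementary_Metric_Spaces"
begin

text \<open>
  For positive semidefinite \<open>X\<close>, the product \<open>\<lambda>\<^sub>1(X) \<cdots> \<lambda>\<^sub>k(X)\<close> is the largest eigenvalue of the \<open>k\<close>-th compound matrix of \<open>X\<close>, the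
  matrix of its \<open>k \<times> k\<close> minors. By Cauchy--Binet (\<open>cauchy_binet\<close>) the compound is multiplicative; it
  also respects adjoints and diagonal matrices, hence real powers (\<open>compound_powm\<close>), and so the
  compound of \<open>P\<^sub>\<alpha>(A,B)\<close> is \<open>P\<^sub>\<alpha>\<close> of the compounds of \<open>A\<close> and \<open>B\<close>; the same holds for \<open>Q\<^sub>\<alpha>\<^sub>,\<^sub>z\<close>.
  Log-majorization therefore reduces to comparing largest eigenvalues, in every dimension. Both
  expressions are homogeneous of degree \<open>\<alpha>\<close> in \<open>A\<close>, so only the bound 1 has to be transferred
  (\<open>log_maj_of_le_one_comparison\<close>). Equality of the full products is the equality of the two
  determinants.

  Write \<open>X = B\<^bsup>-1/2\<^esup> A B\<^bsup>-1/2\<^esup>\<close>. Then \<open>P\<^sub>\<alpha>(A,B) \<le> 1\<close> says \<open>X\<^bsup>\<alpha>\<^esup> \<le> B\<^bsup>-1\<^esup>\<close>, and \<open>Q\<^sub>\<alpha>\<^sub>,\<^sub>z(A,B) \<le> 1\<close> says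
  \<open>A\<^bsup>\<alpha>/z\<^esup> \<le> B\<^bsup>(\<alpha>-1)/z\<^esup>\<close>. Passing between these two inequalities needs only three tools:
  the Loewner--Heinz inequality; its form for negative exponents, in which an inverse power is
  enclosed between powers of the smaller matrix (\<open>sandwich_negative_power\<close>); and the identity
  \<open>(K K\<^sup>*)\<^bsup>s\<^esup> = K (K\<^sup>* K)\<^bsup>s-1\<^esup> K\<^sup>*\<close>, which trades one unit of an exponent for a factor on each side.

  For \<open>\<alpha> < 1\<close> the implication from \<open>Q\<close> to \<open>P\<close> is Furuta's inequality in the form
  \<open>(C\<^bsup>r/2\<^esup> Y\<^bsup>p\<^esup> C\<^bsup>r/2\<^esup>)\<^bsup>r/(p+r)\<^esup> \<le> C\<^bsup>r\<^esup>\<close> for \<open>Y \<le> C\<close>, with \<open>Y = A\<^bsup>\<alpha>/z\<^esup>\<close> and \<open>C = B\<^bsup>(\<alpha>-1)/z\<^esup>\<close>. For \<open>\<alpha> > 1\<close>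
  and large \<open>z\<close>, \<open>Q\<close> follows from \<open>P\<close> in one application of the identity to \<open>A = K K\<^sup>*\<close> with
  \<open>K = B\<^bsup>1/2\<^esup> X\<^bsup>1/2\<^esup>\<close>. For \<open>\<alpha> > 1\<close> and small \<open>z\<close>, the inequality \<open>X\<^bsup>m\<^esup> \<le> B\<^bsup>-m/\<alpha>\<^esup>\<close> is proved for small \<open>m\<close> and
  then propagated from \<open>m\<close> to \<open>m + 2\<close> by \<open>X\<^bsup>m+2\<^esup> = X X\<^bsup>m\<^esup> X\<close> up to \<open>m = \<alpha>\<close>.

  A singular \<open>A\<close> needs no limiting argument: with \<open>0 powr p = 0\<close> for every \<open>p\<close>, a negative power
  is a power of the pseudo-inverse and the power 0 is the projection onto the support, so the law
  \<open>A\<^bsup>a\<^esup> A\<^bsup>b\<^esup> = A\<^bsup>a+b\<^esup>\<close> holds for all real exponents.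
\<close>

section \<open>Adjoints, quadratic forms and diagonalizations\<close>

lemma mat_adjoint_carrier [simp]:
  "A \<in> carrier_mat r c \<Longrightarrow> mat_adjoint A \<in> carrier_mat c r"
  by (auto simp: mat_adjoint_def mat_of_rows_def)

lemma mat_adjoint_index:
  assumes "i < dim_col A" "j < dim_row A"
  shows "mat_adjoint (A :: complex mat) $$ (i, j) = cnj (A $$ (j, i))"
  using assms by (simp add: mat_adjoint_def mat_of_rows_index)

lemma mat_adjoint_mult:
  assumes A: "A \<in> carrier_mat r m" and B: "B \<in> carrier_mat m c"
  shows "mat_adjoint (A * B :: complex mat) = mat_adjoint B * mat_adjoint A"
proof -
  have dA: "mat_adjoint A \<in> carrier_mat m r" and dB: "mat_adjoint B \<in> carrier_mat c m"
    using A B by simp_all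
  show ?thesis
  proof (rule eq_matI)
    fix i j assume "i < dim_row (mat_adjoint B * mat_adjoint A)" "j < dim_col (mat_adjoint B * mat_adjoint A)"
    hence ij: "i < c" "j < r" using dA dB by auto
    have "mat_adjoint (A * B) $$ (i, j) = cnj ((A * B) $$ (j, i))"
      using ij A B by (subst mat_adjoint_index) auto
    also have "\<dots> = (\<Sum>k<m. cnj (A $$ (j, k)) * cnj (B $$ (k, i)))"
      using ij A B by (simp add: scalar_prod_def atLeast0LessThan)
    also have "\<dots> = (\<Sum>k<m. mat_adjoint B $$ (i, k) * mat_adjoint A $$ (k, j))"
      using ij A B by (intro sum.cong) (auto simp: mat_adjoint_index mult.commute)
    also have "\<dots> = (mat_adjoint B * mat_adjoint A) $$ (i, j)"
      using ij dA dB by (simp add: scalar_prod_def atLeast0LessThan)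
    finally show "mat_adjoint (A * B) $$ (i, j) = (mat_adjoint B * mat_adjoint A) $$ (i, j)" .
  qed (use A B carrier_matD[OF dA] carrier_matD[OF dB] carrier_matD[OF mat_adjoint_carrier[of "A * B" r c]]
      in simp_all)
qed

lemma mat_adjoint_adjoint [simp]: "mat_adjoint (mat_adjoint (A :: complex mat)) = A"
proof -
  have A: "A \<in> carrier_mat (dim_row A) (dim_col A)" by simp
  note d = carrier_matD[OF mat_adjoint_carrier[OF A]]
    carrier_matD[OF mat_adjoint_carrier[OF mat_adjoint_carrier[OF A]]]
  show ?thesis
    by (rule eq_matI) (simp_all add: mat_adjoint_index d)
qed

lemma mat_adjoint_one [simp]: "mat_adjoint (1\<^sub>m n :: complex mat) = 1\<^sub>m n"
  using carrier_matD[OF mat_adjoint_carrier[OF one_carrier_mat[of n, where ?'a = complex]]]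
  by (intro eq_matI) (auto simp: mat_adjoint_index)

lemma inner_mat_adjoint:
  assumes A: "A \<in> carrier_mat r c" and v: "v \<in> carrier_vec c" and w: "(w :: complex vec) \<in> carrier_vec r"
  shows "(A *\<^sub>v v) \<bullet>c w = v \<bullet>c (mat_adjoint A *\<^sub>v w)"
proof -
  have "(A *\<^sub>v v) \<bullet>c w = (\<Sum>i<r. \<Sum>j<c. A $$ (i, j) * v $ j * cnj (w $ i))"
    using assms by (simp add: scalar_prod_def atLeast0LessThan sum_distrib_right)
  also have "\<dots> = (\<Sum>j<c. \<Sum>i<r. A $$ (i, j) * v $ j * cnj (w $ i))"
    by (rule sum.swap)
  also have "\<dots> = v \<bullet>c (mat_adjoint A *\<^sub>v w)"
    using assms carrier_matD[OF mat_adjoint_carrier[OF A]]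
    by (simp add: scalar_prod_def atLeast0LessThan sum_distrib_left mat_adjoint_index mult_ac)
  finally show ?thesis .
qed

lemma cnj_inner:
  assumes "v \<in> carrier_vec n" "w \<in> carrier_vec n"
  shows "cnj (v \<bullet>c w) = w \<bullet>c (v :: complex vec)"
  using assms by (simp add: scalar_prod_def mult.commute)

lemma inner_self: "(v :: complex vec) \<bullet>c v = complex_of_real (\<Sum>i<dim_vec v. (cmod (v $ i))\<^sup>2)"
  by (simp add: scalar_prod_def atLeast0LessThan complex_norm_square flip: of_real_power)

abbreviation rdiag :: "nat \<Rightarrow> (nat \<Rightarrow> real) \<Rightarrow> complex mat" where
  "rdiag n d \<equiv> mat_diag n (\<lambda>i. complex_of_real (d i))"

lemma rdiag_adjoint [simp]: "mat_adjoint (rdiag n d) = rdiag n d"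
  using carrier_matD[OF mat_adjoint_carrier[OF mat_diag_dim[of n "\<lambda>i. complex_of_real (d i)"]]]
  by (intro eq_matI) (auto simp: mat_adjoint_index mat_diag_def)

lemma rdiag_mult_vec:
  assumes "v \<in> carrier_vec n" "i < n"
  shows "(rdiag n d *\<^sub>v v) $ i = complex_of_real (d i) * v $ i"
  using assms by (simp add: mat_diag_def scalar_prod_def if_distrib[where f = "\<lambda>x. x * _"] cong: if_cong)

locale square_mats = fixes n :: nat
begin

abbreviation M :: "complex mat set" where "M \<equiv> carrier_mat n n"
abbreviation V :: "complex vec set" where "V \<equiv> carrier_vec n"

lemma mult_M [simp]: "A \<in> M \<Longrightarrow> B \<in> M \<Longrightarrow> A * B \<in> M" by simp
lemma adjoint_M [simp]: "A \<in> M \<Longrightarrow> mat_adjoint A \<in> M" by simp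
lemma mult_V [simp]: "A \<in> M \<Longrightarrow> v \<in> V \<Longrightarrow> A *\<^sub>v v \<in> V" by simp

lemma mult_one [simp]: "A \<in> M \<Longrightarrow> A * 1\<^sub>m n = A" "A \<in> M \<Longrightarrow> 1\<^sub>m n * A = A"
  by simp_all

lemmas massoc = assoc_mult_mat[of _ n n _ n _ n]
lemmas vassoc = assoc_mult_mat_vec[of _ n n _ n]
lemmas madjoint_mult = mat_adjoint_mult[of _ n n _ n]
lemmas inner_adjoint = inner_mat_adjoint[of _ n n]

definition qf :: "complex mat \<Rightarrow> complex vec \<Rightarrow> real" where
  "qf A v = Re ((A *\<^sub>v v) \<bullet>c v)"

definition sqnorm :: "complex vec \<Rightarrow> real" where
  "sqnorm v = Re (v \<bullet>c v)"

lemma sqnorm_sum: "v \<in> V \<Longrightarrow> sqnorm v = (\<Sum>i<n. (cmod (v $ i))\<^sup>2)"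
  by (simp only: sqnorm_def inner_self Re_complex_of_real carrier_vecD)

lemma sqnorm_nonneg: "v \<in> V \<Longrightarrow> 0 \<le> sqnorm v"
  by (simp add: sqnorm_sum sum_nonneg)

lemma sqnorm_eq_0: "v \<in> V \<Longrightarrow> sqnorm v = 0 \<Longrightarrow> v = 0\<^sub>v n"
  by (intro eq_vecI) (auto simp: sqnorm_sum sum_nonneg_eq_0_iff)

lemma qf_one: "v \<in> V \<Longrightarrow> qf (1\<^sub>m n) v = sqnorm v"
  by (simp add: qf_def sqnorm_def)

lemma qf_conj:
  assumes "A \<in> M" "K \<in> M" "v \<in> V"
  shows "qf (K * A * mat_adjoint K) v = qf A (mat_adjoint K *\<^sub>v v)"
  using assms by (simp add: qf_def inner_adjoint vassoc massoc)

lemma qf_gram: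
  assumes "K \<in> M" "v \<in> V"
  shows "qf (mat_adjoint K * K) v = sqnorm (K *\<^sub>v v)"
  using assms by (simp add: qf_def sqnorm_def inner_adjoint vassoc)

lemma herm_conj:
  assumes "A \<in> M" "K \<in> M" "mat_adjoint A = A"
  shows "mat_adjoint (K * A * mat_adjoint K) = K * A * mat_adjoint K"
  using assms by (simp add: madjoint_mult massoc)

lemma herm_inner_real:
  assumes "A \<in> M" "mat_adjoint A = A" "v \<in> V"
  shows "(A *\<^sub>v v) \<bullet>c v = complex_of_real (qf A v)"
proof -
  have "cnj ((A *\<^sub>v v) \<bullet>c v) = v \<bullet>c (A *\<^sub>v v)"
    using assms by (intro cnj_inner[of _ n]) simp_all
  also have "\<dots> = (A *\<^sub>v v) \<bullet>c v"
    using assms by (simp add: inner_adjoint)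
  finally have "Im ((A *\<^sub>v v) \<bullet>c v) = 0"
    by (simp add: complex_eq_iff)
  thus ?thesis by (simp add: qf_def complex_eq_iff)
qed

lemma psd_iff: "psd n A \<longleftrightarrow> A \<in> M \<and> mat_adjoint A = A \<and> (\<forall>v\<in>V. 0 \<le> qf A v)"
proof -
  have "0 \<le> (A *\<^sub>v v) \<bullet>c v \<longleftrightarrow> 0 \<le> qf A v" if "A \<in> M" "mat_adjoint A = A" "v \<in> V" for v
    using herm_inner_real[OF that] by (simp add: less_eq_complex_def)
  thus ?thesis unfolding psd_def by blast
qed

lemma pd_iff: "pd n A \<longleftrightarrow> A \<in> M \<and> mat_adjoint A = A \<and> (\<forall>v\<in>V. v \<noteq> 0\<^sub>v n \<longrightarrow> 0 < qf A v)"
proof -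
  have "0 < (A *\<^sub>v v) \<bullet>c v \<longleftrightarrow> 0 < qf A v" if "A \<in> M" "mat_adjoint A = A" "v \<in> V" for v
    using herm_inner_real[OF that] by (simp add: less_complex_def)
  thus ?thesis unfolding pd_def by blast
qed

lemma qf_zero_vec [simp]: "A \<in> M \<Longrightarrow> qf A (0\<^sub>v n) = 0"
  by (simp add: qf_def)

lemma pd_imp_psd: "pd n A \<Longrightarrow> psd n A"
  unfolding psd_iff pd_iff by (metis less_eq_real_def qf_zero_vec)

lemma psd_M [simp]: "psd n A \<Longrightarrow> A \<in> M" by (simp add: psd_def)
lemma psd_adjoint: "psd n A \<Longrightarrow> mat_adjoint A = A" by (simp add: psd_def)
lemma psd_qf: "psd n A \<Longrightarrow> v \<in> V \<Longrightarrow> 0 \<le> qf A v" by (simp add: psd_iff)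

lemma psd_one [simp]: "psd n (1\<^sub>m n)"
  by (simp add: psd_iff qf_one sqnorm_nonneg)

lemma psd_conj:
  assumes "psd n A" "K \<in> M"
  shows "psd n (K * A * mat_adjoint K)"
  using assms by (auto simp: psd_iff herm_conj qf_conj)

lemma psd_gram: "K \<in> M \<Longrightarrow> psd n (mat_adjoint K * K)"
  by (simp add: psd_iff madjoint_mult qf_gram sqnorm_nonneg)

lemma psd_gram': "K \<in> M \<Longrightarrow> psd n (K * mat_adjoint K)"
  using psd_gram[of "mat_adjoint K"] by simp

definition diagonalizes :: "complex mat \<Rightarrow> (nat \<Rightarrow> real) \<Rightarrow> complex mat \<Rightarrow> bool" where
  "diagonalizes U d A \<longleftrightarrow> unitary n U \<and> A = U * rdiag n d * mat_adjoint U"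

lemma unitary_M [simp]: "unitary n U \<Longrightarrow> U \<in> M" by (simp add: unitary_def)

lemma unitary_left [simp]: "unitary n U \<Longrightarrow> mat_adjoint U * U = 1\<^sub>m n" by (simp add: unitary_def)

lemma unitary_right [simp]: "unitary n U \<Longrightarrow> U * mat_adjoint U = 1\<^sub>m n"
  unfolding unitary_def using mat_mult_left_right_inverse[of "mat_adjoint U" n U] by simp

lemma unitary_cancel [simp]:
  assumes "unitary n U" "X \<in> M"
  shows "mat_adjoint U * (U * X) = X" "U * (mat_adjoint U * X) = X"
proof -
  have "mat_adjoint U * U * X = X" "U * mat_adjoint U * X = X"
    using assms by (simp_all del: assoc_mult_mat)
  thus "mat_adjoint U * (U * X) = X" "U * (mat_adjoint U * X) = X"
    using assms by (simp_all add: massoc del: unitary_left unitary_right)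
qed

lemma diagonalizes_M: "diagonalizes U d A \<Longrightarrow> A \<in> M"
  by (simp add: diagonalizes_def)

lemma diagonalizes_adjoint: "diagonalizes U d A \<Longrightarrow> mat_adjoint A = A"
  by (simp add: diagonalizes_def herm_conj)

text \<open>Comparing entries of \<open>D Z = Z E\<close> gives \<open>(d\<^sub>i - e\<^sub>j) z\<^sub>i\<^sub>j = 0\<close>, so \<open>Z\<close> also intertwines
  \<open>f(D)\<close> and \<open>f(E)\<close>. With \<open>X\<close> the identity this is the independence of the functional calculus
  from the diagonalization.\<close>

lemma functional_calculus_intertwines:
  assumes A: "diagonalizes U d A" and B: "diagonalizes W e B" and X: "X \<in> M"
    and AB: "A * X = X * B"
  shows "(U * rdiag n (\<lambda>i. f (d i)) * mat_adjoint U) * X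
       = X * (W * rdiag n (\<lambda>i. f (e i)) * mat_adjoint W)"
proof -
  have U: "unitary n U" and W: "unitary n W" using A B by (auto simp: diagonalizes_def)
  define Z where "Z = mat_adjoint U * X * W"
  have Z: "Z \<in> M" using U W X by (simp add: Z_def)
  have "rdiag n d * Z = mat_adjoint U * (A * X) * W"
    using A U W X by (simp add: Z_def diagonalizes_def massoc)
  also have "\<dots> = Z * rdiag n e"
    unfolding AB using B U W X by (simp add: Z_def diagonalizes_def massoc)
  finally have eq: "rdiag n d * Z = Z * rdiag n e" .
  have entry: "complex_of_real (d i) * Z $$ (i, j) = Z $$ (i, j) * complex_of_real (e j)"
    if "i < n" "j < n" for i j
    using arg_cong[OF eq, of "\<lambda>m. m $$ (i, j)"] that
    by (simp add: mat_diag_mult_left[OF Z] mat_diag_mult_right[OF Z])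
  have "rdiag n (\<lambda>i. f (d i)) * Z = Z * rdiag n (\<lambda>i. f (e i))"
  proof (rule eq_matI)
    fix i j assume "i < dim_row (Z * rdiag n (\<lambda>i. f (e i)))" "j < dim_col (Z * rdiag n (\<lambda>i. f (e i)))"
    hence ij: "i < n" "j < n" using Z by (auto simp: mat_diag_def)
    show "(rdiag n (\<lambda>i. f (d i)) * Z) $$ (i, j) = (Z * rdiag n (\<lambda>i. f (e i))) $$ (i, j)"
      using entry[OF ij] ij by (auto simp: mat_diag_mult_left[OF Z] mat_diag_mult_right[OF Z])
  qed (use Z in \<open>auto simp: mat_diag_def\<close>)
  hence "U * (rdiag n (\<lambda>i. f (d i)) * Z) * mat_adjoint W
       = U * (Z * rdiag n (\<lambda>i. f (e i))) * mat_adjoint W" by simp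
  thus ?thesis using U W X by (simp add: Z_def massoc)
qed

lemma powm_diagonalizes:
  assumes "diagonalizes U d A"
  shows "A powm p = U * rdiag n (\<lambda>i. d i powr p) * mat_adjoint U"
proof -
  have n: "dim_row A = n" using diagonalizes_M[OF assms] by simp
  show ?thesis unfolding mat_powr_def n
  proof (rule the_equality)
    show "\<exists>W e. unitary n W \<and> A = W * rdiag n e * mat_adjoint W
        \<and> U * rdiag n (\<lambda>i. d i powr p) * mat_adjoint U = W * rdiag n (\<lambda>i. e i powr p) * mat_adjoint W"
      using assms unfolding diagonalizes_def by blast
  next
    fix X assume "\<exists>W e. unitary n W \<and> A = W * rdiag n e * mat_adjoint W
        \<and> X = W * rdiag n (\<lambda>i. e i powr p) * mat_adjoint W"
    then obtain W e where W: "diagonalizes W e A" "unitary n W"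
      and X: "X = W * rdiag n (\<lambda>i. e i powr p) * mat_adjoint W"
      unfolding diagonalizes_def by blast
    have U: "unitary n U" using assms by (simp add: diagonalizes_def)
    have "A * 1\<^sub>m n = 1\<^sub>m n * A" using diagonalizes_M[OF assms]
      by simp
    from functional_calculus_intertwines[OF W(1) assms _ this, of "\<lambda>x. x powr p"] W(2) U
    show "X = U * rdiag n (\<lambda>i. d i powr p) * mat_adjoint U"
      unfolding X by simp
  qed
qed

lemma diagonalizes_powm:
  assumes "diagonalizes U d A"
  shows "diagonalizes U (\<lambda>i. d i powr p) (A powm p)"
  using assms powm_diagonalizes[OF assms, of p] by (simp add: diagonalizes_def)

lemma qf_diagonalizes:
  assumes "diagonalizes U d A" "v \<in> V"
  shows "qf A v = (\<Sum>i<n. d i * (cmod ((mat_adjoint U *\<^sub>v v) $ i))\<^sup>2)"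
proof -
  have U: "unitary n U" using assms by (simp add: diagonalizes_def)
  let ?w = "mat_adjoint U *\<^sub>v v"
  have w: "?w \<in> V" using U assms by simp
  have "qf A v = qf (rdiag n d) ?w"
    using assms U by (simp add: diagonalizes_def qf_conj)
  also have "\<dots> = Re (\<Sum>i<n. (rdiag n d *\<^sub>v ?w) $ i * cnj (?w $ i))"
    unfolding qf_def scalar_prod_def using carrier_vecD[OF w]
    by (simp add: atLeast0LessThan del: index_mult_mat_vec)
  also have "\<dots> = Re (\<Sum>i<n. complex_of_real (d i * (cmod (?w $ i))\<^sup>2))"
    by (intro arg_cong[of _ _ Re] sum.cong refl)
      (simp add: rdiag_mult_vec[OF w] complex_norm_square[unfolded of_real_power] mult.assoc del: index_mult_mat_vec)
  finally show ?thesis by simp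
qed

lemma sqnorm_unitary:
  assumes "unitary n U" "v \<in> V"
  shows "sqnorm (U *\<^sub>v v) = sqnorm v"
  using qf_gram[of U v] assms by (simp add: qf_one)

lemma diagonalizes_eigenvector:
  assumes "diagonalizes U d A" "i < n"
  obtains v where "v \<in> V" "sqnorm v = 1" "A *\<^sub>v v = complex_of_real (d i) \<cdot>\<^sub>v v"
proof
  have U: "unitary n U" using assms by (simp add: diagonalizes_def)
  let ?e = "unit_vec n i :: complex vec"
  have e: "?e \<in> V" by simp
  have "sqnorm ?e = 1"
    using assms(2) by (simp add: sqnorm_sum unit_vec_def if_distrib[of "\<lambda>x. (cmod x)\<^sup>2"] cong: if_cong)
  thus "sqnorm (U *\<^sub>v ?e) = 1" using sqnorm_unitary[OF U e] by simp
  show "U *\<^sub>v ?e \<in> V" using U by simp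
  have De: "rdiag n d *\<^sub>v ?e = complex_of_real (d i) \<cdot>\<^sub>v ?e"
    using assms(2) by (intro eq_vecI) (auto simp: mat_diag_def)
  have "A *\<^sub>v (U *\<^sub>v ?e) = U *\<^sub>v (rdiag n d *\<^sub>v ((mat_adjoint U * U) *\<^sub>v ?e))"
    using assms U by (simp add: diagonalizes_def vassoc del: unitary_left)
  also have "\<dots> = complex_of_real (d i) \<cdot>\<^sub>v (U *\<^sub>v ?e)"
    using U by (simp add: De mult_mat_vec[of _ n n])
  finally show "A *\<^sub>v (U *\<^sub>v ?e) = complex_of_real (d i) \<cdot>\<^sub>v (U *\<^sub>v ?e)" .
qed

lemma qf_eigenvector:
  assumes "v \<in> V" "A \<in> M" "A *\<^sub>v v = complex_of_real c \<cdot>\<^sub>v v"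
  shows "qf A v = c * sqnorm v"
  using assms by (simp add: qf_def sqnorm_def)

lemma psd_diagonalizes_iff:
  assumes "diagonalizes U d A"
  shows "psd n A \<longleftrightarrow> (\<forall>i<n. 0 \<le> d i)"
proof
  assume "psd n A"
  show "\<forall>i<n. 0 \<le> d i"
  proof (intro allI impI)
    fix i assume "i < n"
    then obtain v where v: "v \<in> V" "sqnorm v = 1" "A *\<^sub>v v = complex_of_real (d i) \<cdot>\<^sub>v v"
      using diagonalizes_eigenvector[OF assms] by blast
    show "0 \<le> d i" using psd_qf[OF \<open>psd n A\<close> v(1)] qf_eigenvector[OF v(1) _ v(3)]
        diagonalizes_M[OF assms] v(2) by simp
  qed
next
  assume "\<forall>i<n. 0 \<le> d i"
  thus "psd n A" using assms
    by (auto simp: psd_iff diagonalizes_adjoint diagonalizes_M qf_diagonalizes intro!: sum_nonneg)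
qed

end

section \<open>The spectral theorem\<close>

lemma adjoint_mult_index:
  assumes "A \<in> carrier_mat r c" "B \<in> carrier_mat r c'" "i < c" "j < c'"
  shows "(mat_adjoint A * B) $$ (i, j) = col B j \<bullet>c (col A i :: complex vec)"
  using assms carrier_matD[OF mat_adjoint_carrier[OF assms(1)]]
  by (simp add: scalar_prod_def mat_adjoint_index mult.commute)

lemma adjoint_four_block_diag:
  assumes "A \<in> carrier_mat a a" "B \<in> carrier_mat b b"
  shows "mat_adjoint (four_block_mat A (0\<^sub>m a b) (0\<^sub>m b a) B :: complex mat)
       = four_block_mat (mat_adjoint A) (0\<^sub>m a b) (0\<^sub>m b a) (mat_adjoint B)"
proof -
  have F: "four_block_mat A (0\<^sub>m a b) (0\<^sub>m b a) B \<in> carrier_mat (a + b) (a + b)"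
    using assms by simp
  show ?thesis
    using assms carrier_matD[OF mat_adjoint_carrier[OF F]]
      carrier_matD[OF mat_adjoint_carrier[OF assms(1)]] carrier_matD[OF mat_adjoint_carrier[OF assms(2)]]
    by (intro eq_matI) (auto simp: mat_adjoint_index)
qed

lemma mult_four_block_diag:
  assumes "A \<in> carrier_mat a a" "B \<in> carrier_mat b b" "C \<in> carrier_mat a a" "D \<in> carrier_mat b b"
  shows "four_block_mat A (0\<^sub>m a b) (0\<^sub>m b a) B * four_block_mat C (0\<^sub>m a b) (0\<^sub>m b a) D
       = four_block_mat (A * C) (0\<^sub>m a b) (0\<^sub>m b a) (B * D :: complex mat)"
  using assms by (simp add: mult_four_block_mat[of _ a a _ b _ b _ _ a _ b])

text \<open>Gram--Schmidt leaves the direction of the first vector of a basis unchanged; its output is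
  orthogonal but not normalized, hence the factors \<open>s i\<close>.\<close>

lemma unitary_with_first_column:
  assumes v: "v \<in> carrier_vec n" and v0: "v \<noteq> 0\<^sub>v n"
  obtains U c where "unitary n U" "0 < n" "col U 0 = c \<cdot>\<^sub>v (v :: complex vec)"
proof -
  interpret cof_vec_space n "TYPE(complex)" .
  define b where "b = basis_completion v"
  define ws where "ws = gram_schmidt n b"
  note bc = basis_completion[OF v v0, folded b_def]
  have n: "0 < n" using v v0 by (metis gr0I carrier_vecD vec_of_dim_0)
  obtain vs where bv: "b = v # vs" using bc n by (cases b) auto
  have ws: "set ws \<subseteq> carrier_vec n" "corthogonal ws" "length ws = n"
    using gram_schmidt_result[OF bc(2,4,5) refl] bc(6) by (auto simp: ws_def)
  have hd: "ws ! 0 = v" using gram_schmidt_hd[OF v, of vs] ws n bv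
    by (metis hd_conv_nth length_greater_0_conv ws_def)
  have wsc: "ws ! i \<in> carrier_vec n" if "i < n" for i using ws that by auto
  define s where "s i = complex_of_real (1 / sqrt (Re (ws ! i \<bullet>c ws ! i)))" for i
  define U where "U = mat_of_cols n (map (\<lambda>i. s i \<cdot>\<^sub>v ws ! i) [0..<n])"
  have U: "U \<in> carrier_mat n n" by (simp add: U_def mat_of_cols_def)
  have col: "col U i = s i \<cdot>\<^sub>v ws ! i" if "i < n" for i
    using that wsc by (simp add: U_def)
  have "mat_adjoint U * U = 1\<^sub>m n"
  proof (rule eq_matI)
    fix i j assume "i < dim_row (1\<^sub>m n :: complex mat)" "j < dim_col (1\<^sub>m n :: complex mat)"
    hence ij: "i < n" "j < n" by auto
    have wij: "ws ! j \<bullet>c ws ! i = 0 \<longleftrightarrow> i \<noteq> j"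
      using corthogonalD[OF ws(2), of j i] ij ws(3) by auto
    have "(mat_adjoint U * U) $$ (i, j) = s j * cnj (s i) * (ws ! j \<bullet>c ws ! i)"
      using ij wsc by (simp add: adjoint_mult_index[OF U U] col conjugate_smult_vec
          smult_scalar_prod_distrib[of _ n] scalar_prod_smult_distrib[of _ n])
    also have "\<dots> = (if i = j then 1 else 0)"
    proof (cases "i = j")
      case True
      define q where "q = (\<Sum>k<dim_vec (ws ! i). (cmod (ws ! i $ k))\<^sup>2)"
      have q: "ws ! i \<bullet>c ws ! i = complex_of_real q" unfolding q_def by (rule inner_self)
      have "q \<noteq> 0" using wij True q by auto
      hence "q > 0" unfolding q_def by (metis order_le_less sum_nonneg zero_le_power2)
      moreover have "ws ! j \<bullet>c ws ! j = complex_of_real q" using q True by simp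
      ultimately show ?thesis using True by (simp add: s_def real_sqrt_mult_self flip: of_real_mult)
    qed (use wij in simp)
    finally show "(mat_adjoint U * U) $$ (i, j) = 1\<^sub>m n $$ (i, j)" using ij by simp
  qed (use U carrier_matD[OF mat_adjoint_carrier[OF U]] in auto)
  hence "unitary n U" using U by (simp add: unitary_def)
  moreover have "col U 0 = s 0 \<cdot>\<^sub>v v" using col[OF n] hd by simp
  ultimately show thesis using n that by blast
qed

text \<open>Deflation: in an orthonormal basis that starts with an eigenvector, a Hermitian matrix is the
  direct sum of the eigenvalue and a smaller Hermitian matrix. The eigenvalues are split off in the
  order of the given factorization, so that a decreasing diagonal can be prescribed.\<close>

lemma hermitian_unitary_diagonalization:
  assumes "A \<in> carrier_mat n n" "mat_adjoint A = A" "char_poly A = (\<Prod>e\<leftarrow>es. [:- e, 1:])"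
  shows "\<exists>U. unitary n U \<and> A = U * mat_diag n ((!) es) * mat_adjoint U"
  using assms
proof (induction es arbitrary: n A)
  case Nil
  hence "n = 0" using degree_monic_char_poly[of A n] by simp
  thus ?case using Nil by (intro exI[of _ "1\<^sub>m n"]) (auto simp: unitary_def mat_diag_def)
next
  case (Cons e es n A)
  interpret square_mats n .
  note A = Cons.prems(1) and H = Cons.prems(2)
  have ev: "eigenvalue A e"
    unfolding eigenvalue_root_char_poly[OF A] Cons.prems(3) by simp
  define v where "v = find_eigenvector A e"
  have "eigenvector A v e" unfolding v_def by (rule find_eigenvector[OF A ev])
  hence v: "v \<in> V" "v \<noteq> 0\<^sub>v n" "A *\<^sub>v v = e \<cdot>\<^sub>v v" using A by (auto simp: eigenvector_def)
  obtain U c where U: "unitary n U" and n: "0 < n" and U0: "col U 0 = c \<cdot>\<^sub>v v"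
    using unitary_with_first_column[OF v(1,2)] .
  have UM: "U \<in> M" using U by simp
  define m where "m = n - 1"
  have nm: "n = 1 + m" using n by (simp add: m_def)
  define A' where "A' = mat_adjoint U * A * U"
  have A': "A' \<in> M" using A UM by (simp add: A'_def)
  have AA': "A = U * A' * mat_adjoint U" using A UM U by (simp add: A'_def massoc)
  have H': "mat_adjoint A' = A'" using A UM H by (simp add: A'_def madjoint_mult massoc)
  have col0: "A' $$ (i, 0) = (if i = 0 then e else 0)" if i: "i < n" for i
  proof -
    have "col (A * U) 0 = A *\<^sub>v col U 0" by (rule col_mult2[OF A UM n])
    also have "\<dots> = e \<cdot>\<^sub>v col U 0"
      using v A by (simp add: U0 mult_mat_vec[of _ n n] smult_smult_assoc mult.commute)
    finally have "A' $$ (i, 0) = (e \<cdot>\<^sub>v col U 0) \<bullet>c col U i"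
      using adjoint_mult_index[OF UM mult_M[OF A UM] i n] A UM by (simp add: A'_def massoc)
    also have "\<dots> = e * (mat_adjoint U * U) $$ (i, 0)"
      using adjoint_mult_index[OF UM UM i n] UM i n
      by (simp add: smult_scalar_prod_distrib[of _ n] del: unitary_left)
    finally show ?thesis using U i n by simp
  qed
  have row0: "A' $$ (0, i) = 0" if i: "i < n" "0 < i" for i
    using col0[OF i(1)] mat_adjoint_index[of 0 A' i] H' A' i n by auto
  define A3 where "A3 = mat m m (\<lambda>(i, j). A' $$ (Suc i, Suc j))"
  have A3: "A3 \<in> carrier_mat m m" by (simp add: A3_def)
  let ?E = "mat 1 1 (\<lambda>_. e)"
  have block: "A' = four_block_mat ?E (0\<^sub>m 1 m) (0\<^sub>m m 1) A3"
    using A' nm col0 row0 by (intro eq_matI) (auto simp: A3_def)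
  have entry3: "cnj (A' $$ (Suc j, Suc i)) = A' $$ (Suc i, Suc j)" if "i < m" "j < m" for i j
    using mat_adjoint_index[of "Suc i" A' "Suc j"] A' nm H' that by auto
  have H3: "mat_adjoint A3 = A3"
    using carrier_matD[OF mat_adjoint_carrier[OF A3]] A3 entry3
    by (intro eq_matI) (auto simp: mat_adjoint_index A3_def)
  have "similar_mat A' A"
    by (rule similar_matI[of _ _ "mat_adjoint U" U n]) (use A A' U UM in \<open>simp_all add: A'_def\<close>)
  hence "char_poly A' = [:- e, 1:] * (\<Prod>e\<leftarrow>es. [:- e, 1:])"
    using char_poly_similar Cons.prems(3) by fastforce
  moreover have "char_poly A' = char_poly ?E * char_poly A3"
    unfolding block by (rule char_poly_four_block_zeros_col[of _ _ m]) (use A3 in simp_all)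
  moreover have "char_poly ?E = [:- e, 1:]"
    by (simp add: char_poly_defs det_def sign_def)
  ultimately have "char_poly A3 = (\<Prod>e\<leftarrow>es. [:- e, 1:])"
    by (metis mult_cancel_left pCons_eq_0_iff zero_neq_one)
  from Cons.IH[OF A3 H3 this] obtain U3 where
    U3: "unitary m U3" and A3_eq: "A3 = U3 * mat_diag m ((!) es) * mat_adjoint U3" by blast
  have U3M: "U3 \<in> carrier_mat m m" using U3 unfolding unitary_def by blast
  define W where "W = four_block_mat (1\<^sub>m 1) (0\<^sub>m 1 m) (0\<^sub>m m 1) U3"
  have W: "W \<in> M" unfolding W_def nm by (rule four_block_carrier_mat) (use U3M in simp_all)
  have adjW: "mat_adjoint W = four_block_mat (1\<^sub>m 1) (0\<^sub>m 1 m) (0\<^sub>m m 1) (mat_adjoint U3)"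
    using U3M by (simp add: W_def adjoint_four_block_diag)
  have "mat_adjoint W * W = 1\<^sub>m n"
    unfolding adjW unfolding W_def using U3M conjunct2[OF U3[unfolded unitary_def]]
    by (simp add: mult_four_block_diag nm)
  hence uW: "unitary n W" using W unfolding unitary_def by blast
  have D: "mat_diag n ((!) (e # es)) = four_block_mat ?E (0\<^sub>m 1 m) (0\<^sub>m m 1) (mat_diag m ((!) es))"
    using nm by (intro eq_matI) (auto simp: mat_diag_def nth_Cons split: nat.split)
  have A'W: "A' = W * mat_diag n ((!) (e # es)) * mat_adjoint W"
    unfolding block adjW unfolding D W_def
    using U3M by (simp add: mult_four_block_diag A3_eq)
  have "mat_adjoint (U * W) * (U * W) = 1\<^sub>m n"
    using U W uW by (simp add: madjoint_mult massoc)
  hence "unitary n (U * W)" using UM W unfolding unitary_def by simp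
  moreover have "A = U * W * mat_diag n ((!) (e # es)) * mat_adjoint (U * W)"
    using AA' UM W by (simp add: A'W madjoint_mult massoc)
  ultimately show ?case by blast
qed

lemma proots_prod_list_linear: "proots (\<Prod>e\<leftarrow>es. [:- e, 1:]) = mset (es :: complex list)"
proof (induction es)
  case (Cons e es)
  have "(\<Prod>e\<leftarrow>es. [:- e, 1:]) \<noteq> 0" by (auto simp: prod_list_zero_iff)
  thus ?case using Cons by (simp add: proots_mult del: mult_pCons_left)
qed simp

lemma length_eigvals_desc:
  assumes "A \<in> carrier_mat n n" shows "length (eigvals_desc A) = n"
proof -
  obtain es where "char_poly A = (\<Prod>e\<leftarrow>es. [:- e, 1:])" "length es = n"
    using char_poly_factorized[OF assms] by blast
  thus ?thesis
    by (simp add: eigvals_desc_def proots_prod_list_linear flip: size_mset[of "sorted_list_of_multiset _"])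
qed

lemma eigvals_desc_sorted: "sorted_wrt (\<ge>) (eigvals_desc A)"
  by (simp add: eigvals_desc_def sorted_wrt_rev)

text \<open>The eigenvalues are real, because a diagonal matrix unitarily similar to a Hermitian one is itself
  Hermitian; so \<open>eigvals_desc\<close> merely sorts the roots of the characteristic polynomial.\<close>

lemma (in square_mats) diagonalizes_eigvals_desc:
  assumes A: "A \<in> M" "mat_adjoint A = A"
  shows "\<exists>U. diagonalizes U ((!) (eigvals_desc A)) A"
proof -
  obtain es where es: "char_poly A = (\<Prod>e\<leftarrow>es. [:- e, 1:])" "length es = n"
    using char_poly_factorized[OF A(1)] by blast
  obtain U where U: "unitary n U" "A = U * mat_diag n ((!) es) * mat_adjoint U"
    using hermitian_unitary_diagonalization[OF A es(1)] by blast
  have D: "mat_adjoint U * A * U = mat_diag n ((!) es)"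
    using U by (simp add: massoc)
  have "mat_adjoint (mat_adjoint U * A * U) = mat_adjoint U * A * U"
    using U(1) A by (simp add: madjoint_mult massoc)
  hence herm: "mat_adjoint (mat_diag n ((!) es)) = mat_diag n ((!) es)" unfolding D .
  have real: "e = complex_of_real (Re e)" if e: "e \<in> set es" for e
  proof -
    obtain i where i: "i < n" "e = es ! i" using e es(2) by (auto simp: in_set_conv_nth)
    let ?D = "mat_diag n ((!) es)"
    have "cnj (?D $$ (i, i)) = mat_adjoint ?D $$ (i, i)"
      by (rule mat_adjoint_index[symmetric]) (use i(1) in \<open>simp_all add: mat_diag_def\<close>)
    hence "cnj (?D $$ (i, i)) = ?D $$ (i, i)" by (simp only: herm)
    hence "cnj e = e" using i by (simp add: mat_diag_def)
    thus ?thesis by (simp add: complex_eq_iff)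
  qed
  define es' where "es' = map complex_of_real (eigvals_desc A)"
  have "mset es' = image_mset complex_of_real (image_mset Re (proots (char_poly A)))"
    by (simp add: es'_def eigvals_desc_def)
  also have "\<dots> = image_mset (\<lambda>e. e) (mset es)"
    unfolding es(1) proots_prod_list_linear multiset.map_comp comp_def
    by (rule image_mset_cong) (use real in auto)
  also have "\<dots> = mset es" by simp
  finally have "mset es' = mset es" .
  hence "char_poly A = (\<Prod>e\<leftarrow>es'. [:- e, 1:])"
    unfolding es(1) by (metis mset_map prod_mset_prod_list)
  from hermitian_unitary_diagonalization[OF A this] obtain W where
    W: "unitary n W" "A = W * mat_diag n ((!) es') * mat_adjoint W" by blast
  have "mat_diag n ((!) es') = rdiag n ((!) (eigvals_desc A))"
    using length_eigvals_desc[OF A(1)] by (intro eq_matI) (auto simp: mat_diag_def es'_def)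
  thus ?thesis using W by (auto simp: diagonalizes_def)
qed

section \<open>Real powers of positive semidefinite matrices\<close>

context square_mats
begin

lemma rdiag_cong: "(\<And>i. i < n \<Longrightarrow> f i = g i) \<Longrightarrow> rdiag n f = rdiag n g"
  by (intro eq_matI) (auto simp: mat_diag_def)

lemma psd_diagonalization:
  assumes "psd n A"
  obtains U d where "diagonalizes U d A" "\<And>i. 0 \<le> d i"
proof -
  obtain U where U: "diagonalizes U ((!) (eigvals_desc A)) A"
    using diagonalizes_eigvals_desc[of A] assms psd_adjoint by auto
  define d where "d i = (if i < n then eigvals_desc A ! i else 0)" for i
  have "rdiag n ((!) (eigvals_desc A)) = rdiag n d"
    by (rule rdiag_cong) (simp add: d_def)
  hence "diagonalizes U d A" using U by (simp add: diagonalizes_def)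
  moreover have "0 \<le> d i" for i
    using psd_diagonalizes_iff[OF U] assms by (simp add: d_def)
  ultimately show thesis using that by blast
qed

lemma powm_psd [simp]:
  assumes "psd n A" shows "psd n (A powm p)"
proof -
  obtain U d where "diagonalizes U d A" "\<And>i. 0 \<le> d i" using psd_diagonalization[OF assms] by blast
  thus ?thesis using psd_diagonalizes_iff[OF diagonalizes_powm] by simp
qed

lemma powm_M [simp]: "psd n A \<Longrightarrow> A powm p \<in> M"
  using powm_psd by (rule psd_M)

lemma powm_adjoint [simp]: "psd n A \<Longrightarrow> mat_adjoint (A powm p) = A powm p"
  by (simp add: psd_adjoint)

lemma diagonal_product:
  assumes "unitary n U"
  shows "(U * rdiag n f * mat_adjoint U) * (U * rdiag n g * mat_adjoint U)
       = U * rdiag n (\<lambda>i. f i * g i) * mat_adjoint U"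
proof -
  have "(U * rdiag n f * mat_adjoint U) * (U * rdiag n g * mat_adjoint U)
      = U * (rdiag n f * rdiag n g) * mat_adjoint U"
    using assms by (simp add: massoc del: mat_diag_diag)
  thus ?thesis by simp
qed

lemma powm_add: 
  assumes "psd n A" shows "A powm a * A powm b = A powm (a + b)"
proof -
  obtain U d where U: "diagonalizes U d A" "\<And>i. 0 \<le> d i" using psd_diagonalization[OF assms] by blast
  hence "unitary n U" by (simp add: diagonalizes_def)
  thus ?thesis by (simp only: powm_diagonalizes[OF U(1)] diagonal_product powr_add)
qed

lemma powm_add_left:
  assumes "psd n A" "X \<in> M" shows "A powm a * (A powm b * X) = A powm (a + b) * X"
  using assms massoc[of "A powm a" "A powm b" X] by (simp add: powm_add del: assoc_mult_mat)

lemma powm_one [simp]: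
  assumes "psd n A" shows "A powm 1 = A"
proof -
  obtain U d where U: "diagonalizes U d A" "\<And>i. 0 \<le> d i" using psd_diagonalization[OF assms] by blast
  thus ?thesis by (simp add: powm_diagonalizes[OF U(1)]) (simp add: diagonalizes_def)
qed

lemma powm_powm:
  assumes "psd n A" shows "(A powm a) powm b = A powm (a * b)"
proof -
  obtain U d where U: "diagonalizes U d A" "\<And>i. 0 \<le> d i" using psd_diagonalization[OF assms] by blast
  show ?thesis
    using powm_diagonalizes[OF diagonalizes_powm[OF U(1), of a], of b]
    by (simp add: powm_diagonalizes[OF U(1), of "a * b"] powr_powr)
qed

lemma powm_intertwines:
  assumes A: "psd n A" and B: "psd n B" and X: "X \<in> M" and eq: "A * X = X * B"
  shows "A powm p * X = X * B powm p"
proof -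
  obtain U d where U: "diagonalizes U d A" "\<And>i. 0 \<le> d i" using psd_diagonalization[OF A] by blast
  obtain W e where W: "diagonalizes W e B" "\<And>i. 0 \<le> e i" using psd_diagonalization[OF B] by blast
  show ?thesis
    using functional_calculus_intertwines[OF U(1) W(1) X eq, of "\<lambda>x. x powr p"]
    by (simp only: powm_diagonalizes[OF U(1)] powm_diagonalizes[OF W(1)])
qed

text \<open>\<open>K\<close> intertwines \<open>K K\<^sup>*\<close> and \<open>K\<^sup>* K\<close>, hence also their powers of exponent \<open>s - 1\<close>.\<close>

lemma powm_mult_adjoint:
  assumes K: "K \<in> M"
  shows "(K * mat_adjoint K) powm s = K * (mat_adjoint K * K) powm (s - 1) * mat_adjoint K"
proof -
  note p = psd_gram[OF K] psd_gram'[OF K]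
  have "K * mat_adjoint K * K = K * (mat_adjoint K * K)" using K by (simp add: massoc)
  hence "(K * mat_adjoint K) powm (s - 1) * K = K * (mat_adjoint K * K) powm (s - 1)"
    by (rule powm_intertwines[OF p(2,1) K])
  hence "K * (mat_adjoint K * K) powm (s - 1) * mat_adjoint K
      = (K * mat_adjoint K) powm (s - 1) * K * mat_adjoint K" by simp
  also have "\<dots> = (K * mat_adjoint K) powm (s - 1) * (K * mat_adjoint K) powm 1"
    using K p by (simp only: powm_one) (simp add: massoc)
  also have "\<dots> = (K * mat_adjoint K) powm s"
    using p(2) by (simp only: powm_add) simp
  finally show ?thesis by simp
qed

lemma qf_gram_powm:
  assumes "psd n A" "v \<in> V"
  shows "qf (A powm p) v = sqnorm (A powm (p / 2) *\<^sub>v v)"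
proof -
  have "A powm p = mat_adjoint (A powm (p / 2)) * A powm (p / 2)"
    using assms by (simp add: powm_add)
  thus ?thesis using qf_gram[of "A powm (p / 2)" v] assms by simp
qed

lemma mult_zero_vec [simp]: "A \<in> M \<Longrightarrow> A *\<^sub>v 0\<^sub>v n = 0\<^sub>v n"
  by (intro eq_vecI) auto

lemma psd_qf_eq_0:
  assumes "psd n A" "v \<in> V" "qf A v = 0"
  shows "A *\<^sub>v v = 0\<^sub>v n"
proof -
  have "A powm (1/2) *\<^sub>v v = 0\<^sub>v n"
    using qf_gram_powm[of A v 1] assms by (intro sqnorm_eq_0) simp_all
  hence "A powm (1/2) *\<^sub>v (A powm (1/2) *\<^sub>v v) = 0\<^sub>v n" using assms by simp
  moreover have "A powm (1/2) *\<^sub>v (A powm (1/2) *\<^sub>v v) = A powm 1 *\<^sub>v v"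
    using assms vassoc[of "A powm (1/2)" "A powm (1/2)" v]
    by (simp add: powm_add del: powm_one assoc_mult_mat_vec)
  ultimately show ?thesis using assms(1) by simp
qed

lemma pd_powm_0:
  assumes "pd n A" shows "A powm 0 = 1\<^sub>m n"
proof -
  have A: "psd n A" using assms by (rule pd_imp_psd)
  obtain U d where U: "diagonalizes U d A" "\<And>i. 0 \<le> d i" using psd_diagonalization[OF A] by blast
  have "d i powr 0 = 1" if i: "i < n" for i
  proof -
    obtain v where v: "v \<in> V" "sqnorm v = 1" "A *\<^sub>v v = complex_of_real (d i) \<cdot>\<^sub>v v"
      using diagonalizes_eigenvector[OF U(1) i] .
    have "v \<noteq> 0\<^sub>v n" using v(2) by (auto simp: sqnorm_def)
    hence "0 < qf A v" using assms v(1) by (simp add: pd_iff)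
    thus ?thesis using qf_eigenvector[OF v(1) _ v(3)] A v(2) by simp
  qed
  hence "rdiag n (\<lambda>i. d i powr 0) = rdiag n (\<lambda>_. 1)" by (intro rdiag_cong)
  hence "A powm 0 = U * mat_diag n (\<lambda>_. 1) * mat_adjoint U"
    unfolding powm_diagonalizes[OF U(1)] by simp
  thus ?thesis using U by (simp add: diagonalizes_def)
qed

section \<open>The Loewner order\<close>

text \<open>Both sides are required to be positive semidefinite, so that the real powers of both are
  meaningful.\<close>

definition loewner :: "complex mat \<Rightarrow> complex mat \<Rightarrow> bool" (infix "\<preceq>" 50) where
  "A \<preceq> B \<longleftrightarrow> psd n A \<and> psd n B \<and> (\<forall>v\<in>V. qf A v \<le> qf B v)"

lemma loewner_psd: "A \<preceq> B \<Longrightarrow> psd n A" "A \<preceq> B \<Longrightarrow> psd n B"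
  by (simp_all add: loewner_def)

lemma loewner_trans [trans]: "A \<preceq> B \<Longrightarrow> B \<preceq> C \<Longrightarrow> A \<preceq> C"
  unfolding loewner_def by fastforce

lemma loewner_conj: "A \<preceq> B \<Longrightarrow> K \<in> M \<Longrightarrow> K * A * mat_adjoint K \<preceq> K * B * mat_adjoint K"
  by (auto simp: loewner_def qf_conj psd_conj)

lemma loewner_sandwich: "A \<preceq> B \<Longrightarrow> psd n C \<Longrightarrow> C powm a * A * C powm a \<preceq> C powm a * B * C powm a"
  using loewner_conj[of A B "C powm a"] by simp

lemma loewner_one_iff:
  assumes U: "diagonalizes U d A" and A: "psd n A"
  shows "A \<preceq> 1\<^sub>m n \<longleftrightarrow> (\<forall>i<n. d i \<le> 1)"
proof
  assume le: "A \<preceq> 1\<^sub>m n"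
  show "\<forall>i<n. d i \<le> 1"
  proof (intro allI impI)
    fix i assume "i < n"
    then obtain v where v: "v \<in> V" "sqnorm v = 1" "A *\<^sub>v v = complex_of_real (d i) \<cdot>\<^sub>v v"
      using diagonalizes_eigenvector[OF U] by blast
    show "d i \<le> 1"
      using le v A qf_eigenvector[OF v(1) _ v(3)] by (auto simp: loewner_def qf_one)
  qed
next
  assume d: "\<forall>i<n. d i \<le> 1"
  have UU: "unitary n U" using U by (simp add: diagonalizes_def)
  have "qf A v \<le> qf (1\<^sub>m n) v" if v: "v \<in> V" for v
  proof -
    have Uv: "mat_adjoint U *\<^sub>v v \<in> V" using UU v by simp
    have "qf A v \<le> (\<Sum>i<n. 1 * (cmod ((mat_adjoint U *\<^sub>v v) $ i))\<^sup>2)"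
      unfolding qf_diagonalizes[OF U v] using d by (intro sum_mono mult_right_mono) auto
    also have "\<dots> = sqnorm (mat_adjoint U *\<^sub>v v)" using Uv by (simp add: sqnorm_sum del: index_mult_mat_vec)
    also have "\<dots> = qf (mat_adjoint (mat_adjoint U) * mat_adjoint U) v"
      by (rule qf_gram[symmetric]) (use UU v in simp_all)
    finally show ?thesis using UU by simp
  qed
  thus "A \<preceq> 1\<^sub>m n" using A by (simp add: loewner_def)
qed

lemma powm_le_one_iff:
  assumes A: "psd n A" and z: "0 < z"
  shows "A powm z \<preceq> 1\<^sub>m n \<longleftrightarrow> A \<preceq> 1\<^sub>m n"
proof -
  obtain U d where U: "diagonalizes U d A" "\<And>i. 0 \<le> d i" using psd_diagonalization[OF A] by blast
  have "d i powr z \<le> 1 \<longleftrightarrow> d i \<le> 1" for i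
    using U(2)[of i] z powr_le1[of z "d i"] gr_one_powr[of "d i" z] 
    by (cases "1 < d i") (auto simp: not_less not_le)
  thus ?thesis using loewner_one_iff[OF U(1) A] loewner_one_iff[OF diagonalizes_powm[OF U(1)], of z] A
    by simp
qed

lemma powm_zero_le_one: "psd n A \<Longrightarrow> A powm 0 \<preceq> 1\<^sub>m n"
proof -
  assume A: "psd n A"
  obtain U d where U: "diagonalizes U d A" "\<And>i. 0 \<le> d i" using psd_diagonalization[OF A] by blast
  show ?thesis using loewner_one_iff[OF diagonalizes_powm[OF U(1)], of 0] A by simp
qed

lemma contraction_sqnorm:
  assumes "mat_adjoint T * T \<preceq> 1\<^sub>m n" "T \<in> M" "v \<in> V"
  shows "sqnorm (T *\<^sub>v v) \<le> sqnorm v"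
  using assms by (auto simp: loewner_def qf_one qf_gram)

text \<open>For \<open>W = T T\<^sup>*\<close> the hypothesis gives \<open>W\<^sup>2 = T (T\<^sup>* T) T\<^sup>* \<le> W\<close>, so no eigenvalue of \<open>W\<close> exceeds 1.\<close>

lemma contraction_adjoint:
  assumes T: "T \<in> M" and c: "mat_adjoint T * T \<preceq> 1\<^sub>m n"
  shows "T * mat_adjoint T \<preceq> 1\<^sub>m n"
proof -
  let ?W = "T * mat_adjoint T"
  have W: "psd n ?W" using T by (rule psd_gram')
  obtain U d where U: "diagonalizes U d ?W" "\<And>i. 0 \<le> d i" using psd_diagonalization[OF W] by blast
  have "d i \<le> 1" if i: "i < n" for i
  proof -
    obtain v where v: "v \<in> V" "sqnorm v = 1" "?W *\<^sub>v v = complex_of_real (d i) \<cdot>\<^sub>v v"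
      using diagonalizes_eigenvector[OF U(1) i] .
    have "sqnorm (?W *\<^sub>v v) = (d i)\<^sup>2"
      using v by (simp add: sqnorm_def conjugate_smult_vec power2_eq_square)
    moreover have "sqnorm (?W *\<^sub>v v) \<le> sqnorm (mat_adjoint T *\<^sub>v v)"
      using contraction_sqnorm[OF c T, of "mat_adjoint T *\<^sub>v v"] T v(1) by (simp add: vassoc)
    moreover have "sqnorm (mat_adjoint T *\<^sub>v v) = d i"
      using qf_gram[of "mat_adjoint T" v] qf_eigenvector[OF v(1) _ v(3)] T v(1,2) by simp
    ultimately have "d i * d i \<le> d i * 1" by (simp add: power2_eq_square)
    thus ?thesis using U(2)[of i] by (cases "d i = 0") auto
  qed
  thus ?thesis using loewner_one_iff[OF U(1) W] by blast
qed

end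

section \<open>The Loewner--Heinz inequality\<close>

text \<open>Otherwise the gap of \<open>S\<close> around \<open>x\<close> would have its midpoint in \<open>S\<close>.\<close>

lemma midpoint_closed_interval:
  fixes S :: "real set"
  assumes cl: "closed S" and S01: "0 \<in> S" "1 \<in> S"
    and mid: "\<And>p q. p \<in> S \<Longrightarrow> q \<in> S \<Longrightarrow> (p + q) / 2 \<in> S" and x: "0 \<le> x" "x \<le> 1"
  shows "x \<in> S"
proof (rule ccontr)
  assume xS: "x \<notin> S"
  define L where "L = S \<inter> {..x}"
  define R where "R = S \<inter> {x..}"
  have L: "closed L" "0 \<in> L" "bdd_above L" and R: "closed R" "1 \<in> R" "bdd_below R"
    unfolding L_def R_def using cl S01 x by (auto intro!: closed_Int)
  have l: "Sup L \<in> L" using L by (intro closed_contains_Sup) auto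
  have r: "Inf R \<in> R" using R by (intro closed_contains_Inf) auto
  have lx: "Sup L < x" and xr: "x < Inf R" using l r xS unfolding L_def R_def by (auto simp: less_le)
  let ?m = "(Sup L + Inf R) / 2"
  have m: "?m \<in> S" using l r mid unfolding L_def R_def by blast
  show False
  proof (cases "?m \<le> x")
    case True
    hence "?m \<le> Sup L" using m L by (intro cSup_upper) (auto simp: L_def)
    thus False using lx xr by simp
  next
    case False
    hence "Inf R \<le> ?m" using m R by (intro cInf_lower) (auto simp: R_def)
    thus False using lx xr by simp
  qed
qed

context square_mats
begin

lemma mat_eqI_vec:
  assumes "A \<in> M" "B \<in> M" "\<And>v. v \<in> V \<Longrightarrow> A *\<^sub>v v = B *\<^sub>v v"
  shows "A = B"
proof (rule mat_col_eqI)
  fix i assume "i < dim_col B"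
  hence i: "i < n" using assms by simp
  have eq: "A *\<^sub>v unit_vec n i = B *\<^sub>v unit_vec n i" using assms by simp
  have "X *\<^sub>v unit_vec n i = col X i" if "X \<in> M" for X
    using that i by (intro eq_vecI) auto
  thus "col A i = col B i" using assms(1,2) eq by metis
qed (use assms in auto)

text \<open>\<open>C powm 0\<close> is the projection onto the range of \<open>C\<close>. On the kernel of \<open>C\<close> the quadratic form
  of \<open>Y\<close> vanishes, and hence \<open>Y\<close> does.\<close>

lemma loewner_support:
  assumes "Y \<preceq> C"
  shows "Y * C powm 0 = Y"
proof (rule mat_eqI_vec)
  note p = loewner_psd[OF assms]
  show "Y * C powm 0 \<in> M" "Y \<in> M" using p by simp_all
  fix v assume v: "v \<in> V"
  let ?w = "v - C powm 0 *\<^sub>v v"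
  have w: "?w \<in> V" using v p by simp
  have "C * C powm 0 = C"
    using powm_add[OF p(2), of 1 0] p(2) by simp
  hence "C *\<^sub>v (C powm 0 *\<^sub>v v) = C *\<^sub>v v"
    using vassoc[of C "C powm 0" v] p v by simp
  hence "C *\<^sub>v ?w = 0\<^sub>v n"
    using p v by (simp add: mult_minus_distrib_mat_vec[of _ n n])
  hence "qf C ?w = 0" using w by (simp add: qf_def)
  hence "qf Y ?w = 0" using assms w psd_qf[OF p(1) w] by (auto simp: loewner_def)
  hence "Y *\<^sub>v ?w = 0\<^sub>v n" using p w by (intro psd_qf_eq_0)
  hence "Y *\<^sub>v v - Y *\<^sub>v (C powm 0 *\<^sub>v v) = 0\<^sub>v n"
    using p v by (simp add: mult_minus_distrib_mat_vec[of _ n n])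
  hence "Y *\<^sub>v v = Y *\<^sub>v (C powm 0 *\<^sub>v v)"
    using p v by (intro eq_vecI) (auto simp: vec_eq_iff)
  thus "Y * C powm 0 *\<^sub>v v = Y *\<^sub>v v" using p v by (simp add: vassoc)
qed

lemma loewner_support_powm:
  assumes "Y \<preceq> C"
  shows "Y powm a * C powm 0 = Y powm a" "C powm 0 * Y powm a = Y powm a"
proof -
  note p = loewner_psd[OF assms]
  have "Y powm a * C powm 0 = Y powm (a - 1) * (Y powm 1 * C powm 0)"
    using p by (simp add: powm_add_left del: powm_one)
  also have "\<dots> = Y powm (a - 1) * Y powm 1"
    using loewner_support[OF assms] p by simp
  also have "\<dots> = Y powm a" using p by (simp add: powm_add del: powm_one)
  finally show 1: "Y powm a * C powm 0 = Y powm a" .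
  have "mat_adjoint (Y powm a * C powm 0) = C powm 0 * Y powm a"
    using p by (simp add: madjoint_mult)
  thus "C powm 0 * Y powm a = Y powm a" using 1 p by simp
qed

lemma contraction_quotient:
  assumes "Y powm (2 * a) \<preceq> C powm (2 * a)" "psd n Y" "psd n C"
  shows "mat_adjoint (Y powm a * C powm - a) * (Y powm a * C powm - a) \<preceq> 1\<^sub>m n"
proof -
  have "mat_adjoint (Y powm a * C powm - a) * (Y powm a * C powm - a)
      = C powm - a * Y powm (2 * a) * C powm - a"
    using assms by (simp add: madjoint_mult massoc powm_add powm_add_left)
  also have "\<dots> \<preceq> C powm - a * C powm (2 * a) * C powm - a"
    using assms by (intro loewner_sandwich)
  also have "\<dots> = C powm 0" using assms by (simp add: massoc powm_add)
  also have "\<dots> \<preceq> 1\<^sub>m n" using assms by (intro powm_zero_le_one)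
  finally show ?thesis .
qed

text \<open>As the range of \<open>Y\<close> lies in that of \<open>C\<close>, the conclusion says that
  \<open>G = C\<^bsup>-k\<^esup> Y\<^bsup>2k\<^esup> C\<^bsup>-k\<^esup>\<close> has no eigenvalue above 1. The two hypotheses say that \<open>S = Y\<^bsup>k+h\<^esup> C\<^bsup>-(k+h)\<^esup>\<close>
  and \<open>T = Y\<^bsup>k-h\<^esup> C\<^bsup>-(k-h)\<^esup>\<close> are contractions, and \<open>C\<^bsup>h\<^esup>\<close> maps an eigenvector of \<open>G\<close> with
  nonzero eigenvalue to an eigenvector of the contraction \<open>T\<^sup>* S\<close> with the same eigenvalue.\<close>

lemma loewner_powm_midpoint:
  assumes supp: "Y \<preceq> C"
    and S: "Y powm (2 * (k + h)) \<preceq> C powm (2 * (k + h))"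
    and T: "Y powm (2 * (k - h)) \<preceq> C powm (2 * (k - h))"
  shows "Y powm (2 * k) \<preceq> C powm (2 * k)"
proof -
  have Y: "psd n Y" and C: "psd n C" using supp by (auto dest: loewner_psd)
  let ?S = "Y powm (k + h) * C powm - (k + h)"
  let ?T = "Y powm (k - h) * C powm - (k - h)"
  let ?G = "C powm - k * Y powm (2 * k) * C powm - k"
  have SM: "?S \<in> M" and TM: "?T \<in> M" using Y C by simp_all
  have G: "psd n ?G" using psd_conj[of "Y powm (2 * k)" "C powm - k"] Y C by simp
  obtain U d where U: "diagonalizes U d ?G" "\<And>i. 0 \<le> d i" using psd_diagonalization[OF G] by blast
  have "d i \<le> 1" if i: "i < n" for i
  proof (rule ccontr)
    assume "\<not> d i \<le> 1"
    obtain v where v: "v \<in> V" "sqnorm v = 1" "?G *\<^sub>v v = complex_of_real (d i) \<cdot>\<^sub>v v"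
      using diagonalizes_eigenvector[OF U(1) i] .
    let ?w = "C powm h *\<^sub>v v"
    have w: "?w \<in> V" using C v by simp
    have "mat_adjoint ?T *\<^sub>v (?S *\<^sub>v ?w) = (mat_adjoint ?T * ?S * C powm h) *\<^sub>v v"
      using SM TM C v by (simp add: vassoc massoc)
    also have "mat_adjoint ?T * ?S * C powm h = C powm h * ?G"
      using Y C by (simp add: madjoint_mult massoc powm_add powm_add_left)
    also have "(C powm h * ?G) *\<^sub>v v = C powm h *\<^sub>v (?G *\<^sub>v v)"
      using G C v by (intro vassoc) simp_all
    also have "\<dots> = complex_of_real (d i) \<cdot>\<^sub>v ?w"
      unfolding v(3) using C v by (simp add: mult_mat_vec[of _ n n])
    finally have TS: "mat_adjoint ?T *\<^sub>v (?S *\<^sub>v ?w) = complex_of_real (d i) \<cdot>\<^sub>v ?w" .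
    have "(d i)\<^sup>2 * sqnorm ?w = sqnorm (mat_adjoint ?T *\<^sub>v (?S *\<^sub>v ?w))"
      unfolding TS using w by (simp add: sqnorm_def conjugate_smult_vec power2_eq_square)
    also have "\<dots> \<le> sqnorm (?S *\<^sub>v ?w)"
      using contraction_adjoint[OF TM contraction_quotient[OF T Y C]] SM TM w
      by (intro contraction_sqnorm) simp_all
    also have "\<dots> \<le> sqnorm ?w"
      by (rule contraction_sqnorm[OF contraction_quotient[OF S Y C] SM w])
    finally have le: "(d i)\<^sup>2 * sqnorm ?w \<le> 1 * sqnorm ?w" by simp
    have "1 < (d i)\<^sup>2" using \<open>\<not> d i \<le> 1\<close> by (simp add: one_less_power)
    \<comment> \<open>So \<open>C\<^bsup>h\<^esup>\<close> would kill \<open>v\<close>; but \<open>G\<close> factors through \<open>C\<^bsup>h\<^esup>\<close> from the right, and \<open>v\<close> belongs to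
      a nonzero eigenvalue of \<open>G\<close>.\<close>
    hence "\<not> 0 < sqnorm ?w" using le mult_strict_right_mono[of 1 "(d i)\<^sup>2" "sqnorm ?w"] by linarith
    hence "sqnorm ?w = 0" using sqnorm_nonneg[OF w] by linarith
    hence "?w = 0\<^sub>v n" using w by (intro sqnorm_eq_0)
    hence "?G * C powm - h *\<^sub>v ?w = 0\<^sub>v n" using G C by simp
    moreover have "?G * C powm - h *\<^sub>v ?w = (?G * C powm - h * C powm h) *\<^sub>v v"
      using G C v by (intro vassoc[symmetric]) simp_all
    moreover have "?G * C powm - h * C powm h = ?G"
      using Y C by (simp add: massoc powm_add)
    ultimately have "complex_of_real (d i) \<cdot>\<^sub>v v = 0\<^sub>v n" using v(3) by simp
    hence "v = 0\<^sub>v n" using \<open>\<not> d i \<le> 1\<close> v(1) by (auto simp: vec_eq_iff)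
    thus False using v(2) by (simp add: sqnorm_def)
  qed
  hence "?G \<preceq> 1\<^sub>m n" using loewner_one_iff[OF U(1) G] by blast
  from loewner_sandwich[OF this C, of k]
  have "C powm k * ?G * C powm k \<preceq> C powm k * C powm k" using C by simp
  moreover have "C powm k * ?G * C powm k = C powm 0 * Y powm (2 * k) * C powm 0"
    using Y C by (simp add: massoc powm_add powm_add_left)
  ultimately show ?thesis
    using loewner_support_powm[OF supp] Y C by (simp add: powm_add)
qed

lemma continuous_on_qf_powm:
  assumes "psd n A" "v \<in> V"
  shows "continuous_on UNIV (\<lambda>p. qf (A powm p) v)"
proof -
  obtain U d where U: "diagonalizes U d A" "\<And>i. 0 \<le> d i" using psd_diagonalization[OF assms(1)] by blast
  have "continuous_on UNIV (\<lambda>p. d i powr p)" for i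
    by (cases "d i = 0") (auto intro!: continuous_intros)
  thus ?thesis
    unfolding qf_diagonalizes[OF diagonalizes_powm[OF U(1)] assms(2)]
    by (intro continuous_on_sum continuous_on_mult continuous_on_const)
qed

text \<open>The exponents for which the inequality holds form a closed set that contains 0 and 1 and is
  stable under midpoints.\<close>

theorem loewner_heinz:
  assumes le: "Y \<preceq> C" and p: "0 \<le> p" "p \<le> 1"
  shows "Y powm p \<preceq> C powm p"
proof -
  have Y: "psd n Y" and C: "psd n C" using le by (auto dest: loewner_psd)
  define S where "S = {p. Y powm p \<preceq> C powm p}"
  have "S = (\<Inter>v\<in>V. {p. qf (Y powm p) v \<le> qf (C powm p) v})"
    using Y C by (auto simp: S_def loewner_def)
  also have "closed \<dots>"
    using Y C by (intro closed_INT ballI closed_Collect_le continuous_on_qf_powm)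
  finally have "closed S" .
  moreover have "0 \<in> S"
  proof -
    have "C powm 0 * Y powm 0 * C powm 0 \<preceq> C powm 0 * 1\<^sub>m n * C powm 0"
      using powm_zero_le_one Y C by (intro loewner_sandwich)
    thus ?thesis using loewner_support_powm[OF le, of 0] Y C by (simp add: S_def powm_add)
  qed
  moreover have "1 \<in> S" using le Y C by (simp add: S_def)
  moreover have "(a + b) / 2 \<in> S" if "a \<in> S" "b \<in> S" for a b
  proof -
    have "2 * ((a + b) / 4 + (a - b) / 4) = a" "2 * ((a + b) / 4 - (a - b) / 4) = b"
      "2 * ((a + b) / 4) = (a + b) / 2" by (simp_all add: field_simps)
    thus ?thesis using loewner_powm_midpoint[OF le, of "(a + b) / 4" "(a - b) / 4"] that
      by (simp only: S_def mem_Collect_eq)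
  qed
  ultimately have "p \<in> S" using p by (rule midpoint_closed_interval)
  thus ?thesis by (simp add: S_def)
qed

text \<open>Antitonicity of \<open>x \<mapsto> x\<^bsup>-q\<^esup>\<close> in a form valid for singular matrices: formally
  \<open>R\<^bsup>-q\<^esup> \<le> Y\<^bsup>-mq\<^esup>\<close>, but enclosed between powers of \<open>Y\<close>, so that only the range of \<open>Y\<close> matters. By
  Loewner--Heinz \<open>Y\<^bsup>mq/2\<^esup> R\<^bsup>-q/2\<^esup>\<close> is a contraction; the claim is the contractivity of its adjoint,
  multiplied from both sides by a power of \<open>Y\<close>.\<close>

lemma sandwich_negative_power:
  assumes Y: "psd n Y" and le: "Y powm m \<preceq> R" and q: "0 \<le> q" "q \<le> 1"
  shows "Y powm a * R powm - q * Y powm a \<preceq> Y powm (2 * a - m * q)"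
proof -
  have R: "psd n R" using le by (rule loewner_psd)
  have "Y powm (m * q) \<preceq> R powm q"
    using loewner_heinz[OF le q] Y by (simp add: powm_powm)
  hence "Y powm (2 * (m * q / 2)) \<preceq> (R powm q) powm (2 * (1/2))"
    using R by (simp add: powm_powm)
  hence le': "(Y powm (m * q)) powm (2 * (1/2)) \<preceq> (R powm q) powm (2 * (1/2))"
    using Y by (simp add: powm_powm)
  let ?T = "(Y powm (m * q)) powm (1/2) * (R powm q) powm - (1/2)"
  have T: "?T * mat_adjoint ?T \<preceq> 1\<^sub>m n"
    using contraction_adjoint[OF _ contraction_quotient[OF le']] Y R by simp
  have "?T * mat_adjoint ?T = Y powm (m * q / 2) * R powm - q * Y powm (m * q / 2)"
    using Y R by (simp add: madjoint_mult massoc powm_powm powm_add powm_add_left)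
  with T have "Y powm (m * q / 2) * R powm - q * Y powm (m * q / 2) \<preceq> 1\<^sub>m n" by simp
  from loewner_sandwich[OF this Y, of "a - m * q / 2"] show ?thesis
    using Y R by (simp add: massoc powm_add powm_add_left algebra_simps)
qed

end

section \<open>The Furuta inequality\<close>

context square_mats
begin

lemma powm_loewner_trans:
  assumes "Y powm a \<preceq> C powm b" "psd n Y" "psd n C" "0 \<le> p" "p \<le> 1" "c = a * p" "d = b * p"
  shows "Y powm c \<preceq> C powm d"
  using loewner_heinz[OF assms(1,4,5)] assms by (simp add: powm_powm)

lemma psd_powm_sandwich [simp]: "psd n A \<Longrightarrow> psd n C \<Longrightarrow> psd n (C powm a * A * C powm a)"
  using psd_conj[of A "C powm a"] by simp

lemma psd_powm_sandwich_right [simp]: "psd n A \<Longrightarrow> psd n C \<Longrightarrow> psd n (C powm a * (A * C powm a))"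
  using psd_powm_sandwich[of A C a] by (simp add: massoc)

lemma powm_sandwich:
  assumes "psd n Y" "psd n C"
  shows "(C powm a * Y powm (2 * b) * C powm a) powm s
    = C powm a * Y powm b * (Y powm b * C powm (2 * a) * Y powm b) powm (s - 1) * Y powm b * C powm a"
  using powm_mult_adjoint[of "C powm a * Y powm b" s] assms
  by (simp add: madjoint_mult massoc powm_add powm_add_left)

text \<open>Applying \<open>powm_sandwich\<close> leaves the exponent \<open>s - 1 \<in> [-1, 0]\<close> on
  \<open>Y\<^bsup>p/2\<^esup> C\<^bsup>r\<^esup> Y\<^bsup>p/2\<^esup>\<close>, which dominates \<open>Y\<^bsup>p+r\<^esup>\<close>; the resulting upper bound for the middle factor is exactly \<open>Y\<close>.\<close>

lemma furuta_base:
  assumes le: "Y \<preceq> C" and r: "0 \<le> r" "r \<le> 1" and p: "1 \<le> p"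
  shows "(C powm (r / 2) * Y powm p * C powm (r / 2)) powm ((1 + r) / (p + r)) \<preceq> C powm (1 + r)"
proof -
  have Y: "psd n Y" and C: "psd n C" using le by (auto dest: loewner_psd)
  define s where "s = (1 + r) / (p + r)"
  have s: "0 \<le> s" "s \<le> 1" "(p + r) * s = 1 + r" using r p by (auto simp: s_def)
  let ?R = "Y powm (p / 2) * C powm r * Y powm (p / 2)"
  have "Y powm (p / 2) * Y powm r * Y powm (p / 2) \<preceq> ?R"
    using loewner_heinz[OF le r] Y by (intro loewner_sandwich)
  hence R: "Y powm (p + r) \<preceq> ?R" using Y by (simp add: massoc powm_add add.commute)
  have "Y powm (p / 2) * ?R powm - (1 - s) * Y powm (p / 2) \<preceq> Y powm (2 * (p / 2) - (p + r) * (1 - s))"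
    by (rule sandwich_negative_power[OF Y R]) (use s in auto)
  also have "2 * (p / 2) - (p + r) * (1 - s) = 1" using s(3) by (simp add: algebra_simps)
  finally have "Y powm (p / 2) * ?R powm (s - 1) * Y powm (p / 2) \<preceq> C"
    using le Y by (auto intro: loewner_trans)
  from loewner_sandwich[OF this C, of "r / 2"]
  have "(C powm (r / 2) * Y powm p * C powm (r / 2)) powm s \<preceq> C powm (r / 2) * C powm 1 * C powm (r / 2)"
    using powm_sandwich[OF Y C, of "r / 2" "p / 2" s] Y C by (simp add: massoc)
  thus ?thesis using C by (simp add: s_def massoc powm_add add.commute del: powm_one)
qed

text \<open>The base case with \<open>r = 1\<close>, applied to the inequality already known for \<open>q\<close> in place of
  \<open>Y \<le> C\<close>, yields the inequality for \<open>r = 2 q + 1\<close>. Hence the range of \<open>r\<close> grows without bound.\<close>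

lemma furuta:
  assumes le: "Y \<preceq> C" and r: "0 \<le> r" and p: "1 \<le> p"
  shows "(C powm (r / 2) * Y powm p * C powm (r / 2)) powm ((1 + r) / (p + r)) \<preceq> C powm (1 + r)"
proof -
  have Y: "psd n Y" and C: "psd n C" using le by (auto dest: loewner_psd)
  have "(C powm (r / 2) * Y powm p * C powm (r / 2)) powm ((1 + r) / (p + r)) \<preceq> C powm (1 + r)"
    if "0 \<le> r" "r \<le> real j + 1" for j :: nat and r
    using that
  proof (induction j arbitrary: r)
    case 0
    thus ?case using furuta_base[OF le] p by simp
  next
    case (Suc j)
    show ?case
    proof (cases "r \<le> 1")
      case True
      thus ?thesis using Suc.prems furuta_base[OF le _ _ p] by simp
    next
      case False
      define q where "q = (r - 1) / 2"
      have q: "0 \<le> q" "q \<le> real j + 1" and rq: "r = 2 * q + 1"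
        using False Suc.prems by (auto simp: q_def field_simps)
      let ?W = "C powm (q / 2) * Y powm p * C powm (q / 2)"
      define t where "t = (1 + q) / (p + q)"
      define p' where "p' = (p + q) / (1 + q)"
      have tp: "t * p' = 1" and p': "1 \<le> p'" using q p by (auto simp: t_def p'_def)
      have e: "(1 + 1) / (p' + 1) = (1 + r) / (p + r)"
        using q p by (simp add: p'_def rq field_simps)
      have "?W powm t \<preceq> C powm (1 + q)" unfolding t_def by (rule Suc.IH[OF q])
      note furuta_base[OF this _ _ p', of 1]
      moreover have "(C powm (1 + q)) powm (1 / 2) = C powm ((1 + q) / 2)"
        "(?W powm t) powm p' = ?W" "(C powm (1 + q)) powm (1 + 1) = C powm (1 + r)"
        using Y C by (simp_all add: powm_powm tp) (simp add: rq algebra_simps)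
      ultimately have "(C powm ((1 + q) / 2) * ?W * C powm ((1 + q) / 2)) powm ((1 + r) / (p + r))
          \<preceq> C powm (1 + r)"
        by (simp only: e)
      thus ?thesis
        using Y C by (simp add: massoc powm_add powm_add_left rq add_divide_distrib)
    qed
  qed
  from this[of r "nat \<lceil>r\<rceil>"] show ?thesis using r by (simp add: of_nat_ceiling le_nat_iff) linarith
qed

text \<open>For \<open>p \<ge> 1\<close> this is the Furuta inequality followed by Loewner--Heinz with exponent
  \<open>r / (1 + r)\<close>; for \<open>p < 1\<close> one simply has \<open>Y\<^bsup>p\<^esup> \<le> C\<^bsup>p\<^esup>\<close>.\<close>

lemma furuta_chaotic:
  assumes le: "Y \<preceq> C" and r: "0 < r" and p: "0 < p"
  shows "(C powm (r / 2) * Y powm p * C powm (r / 2)) powm (r / (p + r)) \<preceq> C powm r"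
proof -
  have Y: "psd n Y" and C: "psd n C" using le by (auto dest: loewner_psd)
  let ?W = "C powm (r / 2) * Y powm p * C powm (r / 2)"
  have W: "psd n ?W" using Y C by simp
  show ?thesis
  proof (cases "1 \<le> p")
    case True
    have "?W powm ((1 + r) / (p + r)) \<preceq> C powm (1 + r)" using furuta[OF le _ True] r by simp
    thus ?thesis
      by (rule powm_loewner_trans[OF _ W C, where p = "r / (1 + r)"]) (use r p in auto)
  next
    case False
    have "?W \<preceq> C powm (r / 2) * C powm p * C powm (r / 2)"
      using loewner_heinz[OF le, of p] p False C by (intro loewner_sandwich) auto
    hence "?W powm 1 \<preceq> C powm (p + r)" using W C by (simp add: massoc powm_add add.commute)
    thus ?thesis
      by (rule powm_loewner_trans[OF _ W C, where p = "r / (p + r)"]) (use r p in \<open>auto simp: field_simps\<close>)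
  qed
qed

section \<open>The bound 1 for the two quantities\<close>

lemma pd_sandwich_le_one_iff:
  assumes B: "pd n B" and Y: "psd n Y"
  shows "B powm c * Y * B powm c \<preceq> 1\<^sub>m n \<longleftrightarrow> Y \<preceq> B powm (- 2 * c)"
proof
  have P: "psd n B" using B by (rule pd_imp_psd)
  note [simp] = pd_powm_0[OF B]
  {
    assume "B powm c * Y * B powm c \<preceq> 1\<^sub>m n"
    from loewner_sandwich[OF this P, of "- c"] show "Y \<preceq> B powm (- 2 * c)"
      using P Y by (simp add: massoc powm_add powm_add_left)
  next
    assume "Y \<preceq> B powm (- 2 * c)"
    from loewner_sandwich[OF this P, of c] show "B powm c * Y * B powm c \<preceq> 1\<^sub>m n"
      using P Y by (simp add: massoc powm_add)
  }
qed

lemma P_alpha_le_one_iff: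
  assumes A: "psd n A" and B: "pd n B"
  shows "P_alpha \<alpha> A B \<preceq> 1\<^sub>m n \<longleftrightarrow> (B powm (-1/2) * A * B powm (-1/2)) powm \<alpha> \<preceq> B powm -1"
  unfolding P_alpha_def using pd_sandwich_le_one_iff[OF B, of _ "1/2"] A pd_imp_psd[OF B] by simp

lemma Q_alpha_z_le_one_iff:
  assumes A: "psd n A" and B: "pd n B" and z: "0 < z"
  shows "Q_alpha_z \<alpha> z A B \<preceq> 1\<^sub>m n \<longleftrightarrow> A powm (\<alpha> / z) \<preceq> B powm ((\<alpha> - 1) / z)"
proof -
  have e: "- 2 * ((1 - \<alpha>) / (2 * z)) = (\<alpha> - 1) / z" using z by (simp add: field_simps)
  show ?thesis unfolding Q_alpha_z_def
    using powm_le_one_iff[OF _ z] pd_sandwich_le_one_iff[OF B, of "A powm (\<alpha> / z)" "(1 - \<alpha>) / (2 * z)"]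
      A pd_imp_psd[OF B] unfolding e by simp
qed

lemma P_le_one_of_Q_small_alpha:
  assumes A: "psd n A" and B: "pd n B" and \<alpha>: "0 < \<alpha>" "\<alpha> < 1" and z: "0 < z"
    and Q: "Q_alpha_z \<alpha> z A B \<preceq> 1\<^sub>m n"
  shows "P_alpha \<alpha> A B \<preceq> 1\<^sub>m n"
proof -
  have P: "psd n B" using B by (rule pd_imp_psd)
  define C where "C = B powm ((\<alpha> - 1) / z)"
  define r where "r = z / (1 - \<alpha>)"
  define p where "p = z / \<alpha>"
  have rp: "0 < r" "0 < p" using \<alpha> z by (auto simp: r_def p_def)
  have e: "(\<alpha> - 1) / z * (r / 2) = -1/2" "(\<alpha> - 1) / z * r = -1" "\<alpha> / z * p = 1" "r / (p + r) = \<alpha>"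
    using \<alpha> z by (auto simp: r_def p_def field_simps)
  have "A powm (\<alpha> / z) \<preceq> C" using Q Q_alpha_z_le_one_iff[OF A B z] by (simp add: C_def)
  from furuta_chaotic[OF this rp] show ?thesis
    unfolding C_def using A P by (simp only: powm_powm e powm_one P_alpha_le_one_iff[OF A B])
qed

text \<open>The hypothesis on \<open>z\<close> says that the exponent \<open>s = \<alpha> / z\<close> in \<open>A\<^bsup>s\<^esup> \<le> B\<^bsup>b s\<^esup>\<close>, with \<open>b = (\<alpha> - 1) / \<alpha>\<close>, is
  at least 2 and at least \<open>1 / b\<close>. The first bound is what the step from \<open>m\<close> to \<open>m + 2\<close> consumes,
  the second what the case \<open>1 \<le> m \<le> 2\<close> consumes. The target \<open>X\<^bsup>\<alpha>\<^esup> \<le> B\<^bsup>-1\<^esup>\<close> is \<open>Good \<alpha>\<close>, because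
  \<open>(b - 1) \<alpha> = -1\<close>.\<close>

lemma P_le_one_of_Q_large_alpha:
  assumes A: "psd n A" and B: "pd n B" and \<alpha>: "1 < \<alpha>" and z: "0 < z" "z \<le> min (\<alpha> / 2) (\<alpha> - 1)"
    and Q: "Q_alpha_z \<alpha> z A B \<preceq> 1\<^sub>m n"
  shows "P_alpha \<alpha> A B \<preceq> 1\<^sub>m n"
proof -
  have P: "psd n B" using B by (rule pd_imp_psd)
  note [simp] = pd_powm_0[OF B]
  define b where "b = (\<alpha> - 1) / \<alpha>"
  define s where "s = \<alpha> / z"
  have b: "0 < b" "b < 1" "b * \<alpha> = \<alpha> - 1" using \<alpha> by (auto simp: b_def)
  have s: "2 \<le> s" "1 \<le> b * s"
  proof -
    have "b * s = (\<alpha> - 1) / z" using \<alpha> by (simp add: b_def s_def)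
    thus "2 \<le> s" "1 \<le> b * s" using z by (auto simp: s_def le_divide_eq)
  qed
  have "A powm s \<preceq> B powm (b * s)"
    using Q Q_alpha_z_le_one_iff[OF A B z(1)] \<alpha> z by (simp add: s_def b_def)
  hence AB: "A powm t \<preceq> B powm (b * t)" if "0 \<le> t" "t \<le> s" for t
    by (rule powm_loewner_trans[OF _ A P, where p = "t / s"]) (use that s in auto)
  let ?h = "B powm (- (1/2))"
  let ?X = "?h * A * ?h"
  have X: "psd n ?X" using A P by simp
  define Good where "Good m \<longleftrightarrow> ?X powm m \<preceq> B powm ((b - 1) * m)" for m
  \<comment> \<open>Start of the propagation. The exponents in \<open>[0, 1]\<close> alone would reach only \<open>[2, 3]\<close>, \<open>[4, 5]\<close>, ...\<close>
  have low: "Good m" if "0 \<le> m" "m \<le> 1" for m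
  proof -
    have "A powm 1 \<preceq> B powm (b * 1)" using s by (intro AB) auto
    from loewner_sandwich[OF this P, of "- (1/2)"]
    have "?X powm 1 \<preceq> B powm (b - 1)" using A P X by (simp add: massoc powm_add)
    thus ?thesis unfolding Good_def
      by (rule powm_loewner_trans[OF _ X P, where p = m]) (use that in auto)
  qed
  have mid: "Good m" if m: "1 \<le> m" "m \<le> 2" "m \<le> \<alpha>" for m
  proof -
    let ?G = "A powm (1/2) * B powm -1 * A powm (1/2)"
    \<comment> \<open>\<open>B\<^bsup>-1\<^esup>\<close> is the power \<open>-1 / (b s)\<close> of \<open>B\<^bsup>b s\<^esup>\<close>, and this exponent lies in \<open>[-1, 0]\<close>.\<close>
    have "B powm -1 = (B powm (b * s)) powm - (1 / (b * s))" using P b s by (simp add: powm_powm)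
    hence "?G powm 1 \<preceq> A powm (2 * (1/2) - s * (1 / (b * s)))"
      using sandwich_negative_power[OF A AB[of s], of "1 / (b * s)" "1/2"] s b A P by simp
    also have "2 * (1/2) - s * (1 / (b * s)) = 1 - 1 / b" using s b by simp
    finally have "?G powm (m - 1) \<preceq> A powm ((1 - 1 / b) * (m - 1))"
      by (rule powm_loewner_trans[OF _ _ A, where p = "m - 1"]) (use m A P in auto)
    from loewner_sandwich[OF this A, of "1/2"]
    have "A powm (1/2) * ?G powm (m - 1) * A powm (1/2) \<preceq> A powm (1 + (1 - 1 / b) * (m - 1))"
      using A P by (simp add: massoc powm_add algebra_simps)
    also have "\<dots> \<preceq> B powm (b * (1 + (1 - 1 / b) * (m - 1)))"
    proof (rule AB)
      have "(1 - 1 / b) * (m - 1) = - ((m - 1) / (\<alpha> - 1))" using \<alpha> b by (simp add: b_def field_simps)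
      moreover have "(m - 1) / (\<alpha> - 1) \<le> 1" "0 \<le> (m - 1) / (\<alpha> - 1)" using m \<alpha> by auto
      ultimately show "0 \<le> 1 + (1 - 1 / b) * (m - 1)" "1 + (1 - 1 / b) * (m - 1) \<le> s"
        using s by linarith+
    qed
    also have "b * (1 + (1 - 1 / b) * (m - 1)) = 1 + (b - 1) * m" using b by (simp add: field_simps)
    finally have "A powm (1/2) * ?G powm (m - 1) * A powm (1/2) \<preceq> B powm (1 + (b - 1) * m)" .
    from loewner_sandwich[OF this P, of "- (1/2)"] show ?thesis
      unfolding Good_def
      using powm_sandwich[OF A P, of "- (1/2)" "1/2" m] A P by (simp add: massoc powm_add)
  qed
  have step: "Good (m + 2)" if m: "0 \<le> m" "m + 2 \<le> \<alpha>" and g: "Good m" for m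
  proof -
    \<comment> \<open>In the middle of \<open>X X\<^bsup>m\<^esup> X\<close> there remains \<open>A B\<^bsup>-c\<^esup> A\<close>, and \<open>B\<^bsup>-c\<^esup>\<close> is the power \<open>-q\<close> of
      \<open>B\<^bsup>2 b\<^esup>\<close>, which dominates \<open>A\<^sup>2\<close>. The condition \<open>q \<le> 1\<close> amounts to \<open>m + 2 \<le> \<alpha>\<close>.\<close>
    define c where "c = 1 + (1 - b) * m"
    define q where "q = c / (b * 2)"
    have c: "0 \<le> q" "q \<le> 1" "2 * 1 - 2 * q = 2 - c / b" "c / b \<le> 2"
    proof -
      have "c = (\<alpha> + m) / \<alpha>" "b * 2 = 2 * (\<alpha> - 1) / \<alpha>" using \<alpha> by (auto simp: c_def b_def field_simps)
      hence "q = (\<alpha> + m) / (2 * (\<alpha> - 1))" using \<alpha> by (simp add: q_def)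
      thus "0 \<le> q" "q \<le> 1" using m \<alpha> by (simp_all add: divide_le_eq)
      thus "2 * 1 - 2 * q = 2 - c / b" "c / b \<le> 2" using b by (auto simp: q_def field_simps)
    qed
    have "?X * ?X powm m * ?X \<preceq> ?X * B powm ((b - 1) * m) * ?X"
      using loewner_sandwich[OF g[unfolded Good_def] X, of 1] X by (simp only: powm_one)
    moreover have "?X * ?X powm m * ?X = ?X powm (m + 2)"
    proof -
      have "?X * ?X powm m * ?X = ?X powm 1 * ?X powm m * ?X powm 1" using X by (simp only: powm_one)
      also have "\<dots> = ?X powm (1 + m + 1)" using X by (simp only: powm_add)
      finally show ?thesis by (simp add: add.commute)
    qed
    moreover have "?X * B powm ((b - 1) * m) * ?X = ?h * (A * B powm - c * A) * ?h"
      using A P by (simp add: massoc powm_add powm_add_left c_def algebra_simps)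
    moreover have "?h * (A * B powm - c * A) * ?h \<preceq> ?h * B powm (b * (2 - c / b)) * ?h"
    proof (intro loewner_sandwich P)
      have "B powm - c = (B powm (b * 2)) powm - q" using P b by (simp add: powm_powm q_def)
      moreover have "A powm 1 * (B powm (b * 2)) powm - q * A powm 1 \<preceq> A powm (2 * 1 - 2 * q)"
        by (rule sandwich_negative_power[OF A AB]) (use c s in auto)
      ultimately have "A * B powm - c * A \<preceq> A powm (2 - c / b)" using A c by (simp only: powm_one)
      also have "\<dots> \<preceq> B powm (b * (2 - c / b))"
        using c s b m \<alpha> by (intro AB) (auto simp: c_def intro!: divide_nonneg_pos add_nonneg_nonneg
            order_trans[of "2 - _ / b" 2])
      finally show "A * B powm - c * A \<preceq> B powm (b * (2 - c / b))" .
    qed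
    moreover have "?h * B powm (b * (2 - c / b)) * ?h = B powm ((b - 1) * (m + 2))"
    proof -
      have "?h * B powm (b * (2 - c / b)) * ?h = B powm (- (1/2) + b * (2 - c / b) + - (1/2))"
        using P by (simp only: powm_add)
      also have "- (1/2) + b * (2 - c / b) + - (1/2) = (b - 1) * (m + 2)"
        using b by (simp add: right_diff_distrib) (simp add: c_def algebra_simps)
      finally show ?thesis .
    qed
    ultimately show ?thesis unfolding Good_def by (auto intro: loewner_trans)
  qed
  have "Good m" if "0 \<le> m" "m \<le> \<alpha>" "m \<le> 2 * real j + 2" for j :: nat and m
    using that
  proof (induction j arbitrary: m)
    case 0
    thus ?case using low mid by (cases "m \<le> 1") auto
  next
    case (Suc j)
    show ?case
    proof (cases "m \<le> 2")
      case True
      thus ?thesis using low mid Suc.prems by (cases "m \<le> 1") auto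
    next
      case False
      hence "Good (m - 2)" using Suc by (intro Suc.IH) auto
      thus ?thesis using step[of "m - 2"] False Suc.prems by simp
    qed
  qed
  from this[of \<alpha> "nat \<lceil>\<alpha>\<rceil>"] have "Good \<alpha>" using \<alpha> by linarith
  moreover have "(b - 1) * \<alpha> = -1" using b by (simp add: algebra_simps)
  ultimately show ?thesis unfolding P_alpha_le_one_iff[OF A B] Good_def by simp
qed

text \<open>Write \<open>A = K K\<^sup>*\<close> with \<open>K = B\<^bsup>1/2\<^esup> X\<^bsup>1/2\<^esup>\<close>. From \<open>X\<^bsup>\<alpha>\<^esup> \<le> B\<^bsup>-1\<^esup>\<close> one gets \<open>K\<^sup>* K \<le> X\<^bsup>1-\<alpha>\<^esup>\<close>, and then
  \<open>A\<^bsup>s\<^esup> \<le> B\<^bsup>1/2\<^esup> X\<^bsup>e\<^esup> B\<^bsup>1/2\<^esup>\<close> with \<open>e = 1 - (\<alpha> - 1) (s - 1)\<close>. The hypothesis on \<open>z\<close> is equivalent to \<open>s \<le> 2\<close>,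
  which permits the power \<open>s - 1\<close> in Loewner--Heinz, together with \<open>e \<ge> 0\<close>. If \<open>s \<le> 1\<close>, it is enough to
  raise \<open>A \<le> B\<^bsup>1-1/\<alpha>\<^esup>\<close> to the power \<open>s\<close>.\<close>

lemma Q_le_one_of_P:
  assumes A: "psd n A" and B: "pd n B" and \<alpha>: "1 < \<alpha>" and z: "max (\<alpha> / 2) (\<alpha> - 1) \<le> z"
    and Pa: "P_alpha \<alpha> A B \<preceq> 1\<^sub>m n"
  shows "Q_alpha_z \<alpha> z A B \<preceq> 1\<^sub>m n"
proof -
  have P: "psd n B" using B by (rule pd_imp_psd)
  note [simp] = pd_powm_0[OF B]
  have z0: "0 < z" using z \<alpha> by auto
  define s where "s = \<alpha> / z"
  have s: "0 < s" "s \<le> 2" "(\<alpha> - 1) * s \<le> \<alpha>"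
  proof -
    have "(\<alpha> - 1) * s = \<alpha> * ((\<alpha> - 1) / z)" by (simp add: s_def)
    also have "\<dots> \<le> \<alpha> * 1" using z z0 \<alpha> by (intro mult_left_mono) (auto simp: divide_le_eq)
    finally show "(\<alpha> - 1) * s \<le> \<alpha>" by simp
    show "0 < s" "s \<le> 2" using z z0 \<alpha> by (auto simp: s_def divide_le_eq)
  qed
  let ?X = "B powm (- (1/2)) * A * B powm (- (1/2))"
  define X where "X = ?X"
  have X: "psd n X" unfolding X_def using A P by simp
  have XB: "X powm \<alpha> \<preceq> B powm -1"
    using Pa unfolding P_alpha_le_one_iff[OF A B] by (simp add: X_def)
  have X_le: "X powm t \<preceq> B powm (- (t / \<alpha>))" if "0 \<le> t" "t \<le> \<alpha>" for t
    by (rule powm_loewner_trans[OF XB X P, where p = "t / \<alpha>"]) (use that \<alpha> in auto)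
  have A_eq: "A = B powm (1/2) * X powm (2 * (1/2)) * B powm (1/2)"
    using A P by (simp add: X_def massoc powm_add_left powm_add)
  have "A powm s \<preceq> B powm ((\<alpha> - 1) / \<alpha> * s)"
  proof (cases "s \<le> 1")
    case True
    have "B powm (1/2) * X powm 1 * B powm (1/2) \<preceq> B powm (1/2) * B powm (- (1 / \<alpha>)) * B powm (1/2)"
      using \<alpha> by (intro loewner_sandwich X_le P) auto
    hence "A powm 1 \<preceq> B powm ((\<alpha> - 1) / \<alpha>)"
      using A P A_eq \<alpha> by (simp add: massoc powm_add diff_divide_distrib)
    thus ?thesis by (rule powm_loewner_trans[OF _ A P, where p = s]) (use s True in auto)
  next
    case False
    let ?G = "X powm (1/2) * B powm (2 * (1/2)) * X powm (1/2)"
    define e where "e = 1 - (\<alpha> - 1) * (s - 1)"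
    have e: "0 \<le> e" "e \<le> \<alpha>"
      using s False \<alpha> by (auto simp: e_def algebra_simps intro: order_trans[of _ 1]) 
    have B1: "(B powm -1) powm -1 = B" using P by (simp add: powm_powm)
    have "X powm (1/2) * (B powm -1) powm -1 * X powm (1/2) \<preceq> X powm (2 * (1/2) - \<alpha> * 1)"
      by (rule sandwich_negative_power[OF X XB]) auto
    hence "?G powm 1 \<preceq> X powm (1 - \<alpha>)" using X P by (simp add: B1)
    hence "?G powm (s - 1) \<preceq> X powm ((1 - \<alpha>) * (s - 1))"
      by (rule powm_loewner_trans[OF _ _ X, where p = "s - 1"]) (use s False X P in auto)
    from loewner_sandwich[OF this X, of "1/2"]
    have "X powm (1/2) * ?G powm (s - 1) * X powm (1/2) \<preceq> X powm e"
      using X by (simp add: massoc powm_add e_def algebra_simps)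
    also have "\<dots> \<preceq> B powm (- (e / \<alpha>))" using e by (rule X_le)
    finally have "B powm (1/2) * (X powm (1/2) * ?G powm (s - 1) * X powm (1/2)) * B powm (1/2)
        \<preceq> B powm (1/2) * B powm (- (e / \<alpha>)) * B powm (1/2)"
      using P by (intro loewner_sandwich)
    moreover have "B powm (1/2) * (X powm (1/2) * ?G powm (s - 1) * X powm (1/2)) * B powm (1/2) = A powm s"
      unfolding A_eq powm_sandwich[OF X P] using X P by (simp add: massoc)
    moreover have "B powm (1/2) * B powm (- (e / \<alpha>)) * B powm (1/2) = B powm ((\<alpha> - 1) / \<alpha> * s)"
    proof -
      have "1 - e / \<alpha> = (\<alpha> - 1) / \<alpha> * s" using \<alpha> by (simp add: e_def field_simps)
      thus ?thesis using P by (simp add: massoc powm_add)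
    qed
    ultimately show ?thesis by simp
  qed
  moreover have "(\<alpha> - 1) / \<alpha> * s = (\<alpha> - 1) / z" using \<alpha> by (simp add: s_def)
  ultimately show ?thesis unfolding Q_alpha_z_le_one_iff[OF A B z0] by (simp only: s_def)
qed

end

section \<open>Compound matrices\<close>

text \<open>The \<open>k\<close>-element subsets of \<open>{0..<n}\<close>, represented by their increasing enumerations; the position
  in the list serves as the row or column index of the compound matrix.\<close>

definition increasing_lists :: "nat \<Rightarrow> nat \<Rightarrow> nat list list" where
  "increasing_lists n k = filter (sorted_wrt (<)) (List.n_lists k [0..<n])"

lemma increasing_listsD:
  assumes "xs \<in> set (increasing_lists n k)"
  shows "length xs = k" "set xs \<subseteq> {0..<n}" "sorted_wrt (<) xs" "distinct xs"
  using assms by (auto simp: increasing_lists_def set_n_lists strict_sorted_iff)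

lemma set_increasing_lists:
  "set (increasing_lists n k) = {xs. length xs = k \<and> set xs \<subseteq> {0..<n} \<and> sorted_wrt (<) xs}"
  by (auto simp: increasing_lists_def set_n_lists)

lemma distinct_increasing_lists: "distinct (increasing_lists n k)"
  by (simp add: increasing_lists_def distinct_n_lists)

lemma nth_less_bound: "set xs \<subseteq> {0..<n} \<Longrightarrow> a < length xs \<Longrightarrow> xs ! a < (n :: nat)"
  using nth_mem by fastforce

definition minor :: "nat \<Rightarrow> complex mat \<Rightarrow> nat list \<Rightarrow> nat list \<Rightarrow> complex" where
  "minor k A xs ys = det (mat k k (\<lambda>(a, b). A $$ (xs ! a, ys ! b)))"

definition compound :: "nat \<Rightarrow> nat \<Rightarrow> complex mat \<Rightarrow> complex mat" where
  "compound n k A = (let L = increasing_lists n k in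
     mat (length L) (length L) (\<lambda>(i, j). minor k A (L ! i) (L ! j)))"

abbreviation compound_dim :: "nat \<Rightarrow> nat \<Rightarrow> nat" where
  "compound_dim n k \<equiv> length (increasing_lists n k)"

lemma compound_carrier [simp]:
  "compound n k A \<in> carrier_mat (compound_dim n k) (compound_dim n k)"
  by (simp add: compound_def Let_def)

text \<open>An injective selection of row indices is an increasing list followed by a permutation.\<close>

lemma bij_betw_increasing_permutation:
  "bij_betw (\<lambda>(zs, \<pi>). restrict (\<lambda>a. zs ! \<pi> a) {0..<k})
     (set (increasing_lists n k) \<times> {\<pi>. \<pi> permutes {0..<k}})
     {f \<in> {0..<k} \<rightarrow>\<^sub>E {0..<n}. inj_on f {0..<k}}"
    (is "bij_betw ?h (?L \<times> ?P) ?F")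
  unfolding bij_betw_def
proof
  have image: "?h (zs, \<pi>) ` {0..<k} = set zs" and inj: "inj_on (?h (zs, \<pi>)) {0..<k}"
    if "zs \<in> ?L" "\<pi> \<in> ?P" for zs \<pi>
  proof -
    note zs = increasing_listsD[OF that(1)]
    have \<pi>: "\<pi> ` {0..<k} = {0..<k}" "inj_on \<pi> {0..<k}"
      using that(2) by (auto simp: permutes_image permutes_inj_on)
    have "?h (zs, \<pi>) ` {0..<k} = (!) zs ` \<pi> ` {0..<k}" by auto
    thus "?h (zs, \<pi>) ` {0..<k} = set zs" using zs \<pi>(1) by (auto simp: set_conv_nth)
    have "inj_on ((!) zs) {0..<k}" using zs by (auto simp: inj_on_def nth_eq_iff_index_eq)
    hence "inj_on ((!) zs \<circ> \<pi>) {0..<k}" using \<pi> by (intro comp_inj_on) auto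
    thus "inj_on (?h (zs, \<pi>)) {0..<k}" by (simp add: inj_on_def)
  qed
  show "inj_on ?h (?L \<times> ?P)"
  proof (rule inj_onI, clarify)
    fix zs \<pi> zs' \<pi>'
    assume zs: "zs \<in> ?L" "zs' \<in> ?L" and \<pi>: "\<pi> permutes {0..<k}" "\<pi>' permutes {0..<k}"
      and eq: "restrict (\<lambda>a. zs ! \<pi> a) {0..<k} = restrict (\<lambda>a. zs' ! \<pi>' a) {0..<k}"
    have "set zs = set zs'"
      using image[OF zs(1), of \<pi>] image[OF zs(2), of \<pi>'] \<pi> eq by simp
    hence zz: "zs = zs'"
      using increasing_listsD(3)[OF zs(1)] increasing_listsD(3)[OF zs(2)]
      by (simp add: strict_sorted_equal)
    have "\<pi> a = \<pi>' a" for a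
    proof (cases "a < k")
      case True
      hence "zs ! \<pi> a = zs ! \<pi>' a" using fun_cong[OF eq, of a] zz by simp
      moreover have "\<pi> a < k" "\<pi>' a < k" using \<pi> True permutes_in_image[of _ "{0..<k}" a] by auto
      ultimately show ?thesis
        using increasing_listsD[OF zs(1)] by (simp add: nth_eq_iff_index_eq)
    next
      case False
      thus ?thesis using \<pi> by (simp add: permutes_def)
    qed
    thus "zs = zs' \<and> \<pi> = \<pi>'" using zz by auto
  qed
  show "?h ` (?L \<times> ?P) = ?F"
  proof (intro equalityI subsetI)
    fix f assume "f \<in> ?h ` (?L \<times> ?P)"
    then obtain zs \<pi> where *: "f = ?h (zs, \<pi>)" "zs \<in> ?L" "\<pi> \<in> ?P" by auto
    have "f ` {0..<k} \<subseteq> {0..<n}" unfolding *(1) image[OF *(2,3)] by (rule increasing_listsD(2)[OF *(2)])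
    moreover have "inj_on f {0..<k}" unfolding *(1) by (rule inj[OF *(2,3)])
    moreover have "f \<in> extensional {0..<k}" unfolding *(1) by simp
    ultimately show "f \<in> ?F" by (auto simp: PiE_def)
  next
    fix f assume f: "f \<in> ?F"
    define S where "S = f ` {0..<k}"
    define zs where "zs = sorted_list_of_set S"
    have S: "finite S" "card S = k" "S \<subseteq> {0..<n}"
      using f by (auto simp: S_def card_image)
    have zs: "zs \<in> ?L" using S by (auto simp: zs_def set_increasing_lists)
    have set_zs: "set zs = S" "length zs = k" "distinct zs" using S by (auto simp: zs_def)
    have bf: "bij_betw f {0..<k} S" using f by (auto simp: bij_betw_def S_def)
    have bz: "bij_betw ((!) zs) {0..<k} S"
      using bij_betw_nth[OF set_zs(3), of "{0..<k}" S] set_zs by (auto simp: atLeast0LessThan)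
    define \<pi> where "\<pi> a = (if a \<in> {0..<k} then inv_into {0..<k} ((!) zs) (f a) else a)" for a
    have "bij_betw (inv_into {0..<k} ((!) zs) \<circ> f) {0..<k} {0..<k}"
      by (rule bij_betw_trans[OF bf bij_betw_inv_into[OF bz]])
    hence "bij_betw \<pi> {0..<k} {0..<k}"
      by (rule bij_betw_cong[THEN iffD1, rotated]) (simp add: \<pi>_def)
    hence "\<pi> permutes {0..<k}" by (rule bij_imp_permutes) (auto simp: \<pi>_def)
    moreover have "f = ?h (zs, \<pi>)"
    proof
      fix a
      show "f a = ?h (zs, \<pi>) a"
      proof (cases "a \<in> {0..<k}")
        case True
        hence "f a \<in> S" by (simp add: S_def)
        hence "zs ! \<pi> a = f a" using bij_betw_inv_into_right[OF bz] True by (simp add: \<pi>_def)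
        thus ?thesis using True by simp
      next
        case False
        thus ?thesis using f by (auto simp: PiE_def extensional_def)
      qed
    qed
    ultimately show "f \<in> ?h ` (?L \<times> ?P)" using zs by blast
  qed
qed

text \<open>Expanding the product inside the determinant gives a sum over all selections \<open>f\<close> of \<open>k\<close> rows of
  \<open>B\<close>. Selections with a repetition contribute 0; for the others the permutation part of \<open>f\<close> turns
  the remaining product of entries of \<open>A\<close> into a determinant.\<close>

lemma cauchy_binet:
  assumes A: "A \<in> carrier_mat n n" and B: "B \<in> carrier_mat n n"
    and xs: "length xs = k" "set xs \<subseteq> {0..<n}" and ys: "length ys = k" "set ys \<subseteq> {0..<n}"
  shows "minor k (A * B) xs ys = (\<Sum>zs\<leftarrow>increasing_lists n k. minor k A xs zs * minor k B zs ys)"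
proof -
  let ?P = "{p. p permutes {0..<k}}"
  let ?L = "set (increasing_lists n k)"
  let ?F = "{0..<k} \<rightarrow>\<^sub>E {0..<n}"
  define G where "G f = det (mat k k (\<lambda>(a, b). B $$ (f a, ys ! b)))" for f :: "nat \<Rightarrow> nat"
  define H where "H f = (\<Prod>a = 0..<k. A $$ (xs ! a, f a)) * G f" for f :: "nat \<Rightarrow> nat"
  have xn: "xs ! a < n" and yn: "ys ! a < n" if "a < k" for a
    using that xs ys by (auto intro: nth_less_bound)
  have G_def': "G f = (\<Sum>p\<in>?P. signof p * (\<Prod>a = 0..<k. B $$ (f a, ys ! p a)))" for f
  proof -
    have "G f = (\<Sum>p\<in>?P. signof p * (\<Prod>a = 0..<k. mat k k (\<lambda>(a, b). B $$ (f a, ys ! b)) $$ (a, p a)))"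
      unfolding G_def by (rule det_def') simp
    also have "\<dots> = (\<Sum>p\<in>?P. signof p * (\<Prod>a = 0..<k. B $$ (f a, ys ! p a)))"
      by (intro sum.cong prod.cong arg_cong2[of _ _ _ _ "(*)"]) (auto dest!: permutes_in_image)
    finally show ?thesis .
  qed
  have "minor k (A * B) xs ys
      = (\<Sum>p\<in>?P. signof p * (\<Prod>a = 0..<k. mat k k (\<lambda>(a, b). (A * B) $$ (xs ! a, ys ! b)) $$ (a, p a)))"
    unfolding minor_def by (rule det_def') simp
  also have "\<dots> = (\<Sum>p\<in>?P. signof p * (\<Prod>a = 0..<k. \<Sum>l\<in>{0..<n}. A $$ (xs ! a, l) * B $$ (l, ys ! p a)))"
  proof (intro sum.cong prod.cong arg_cong2[of _ _ _ _ "(*)"] refl)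
    fix p a assume "p \<in> ?P" "a \<in> {0..<k}"
    hence "a < k" "p a < k" using permutes_in_image[of p "{0..<k}" a] by auto
    thus "mat k k (\<lambda>(a, b). (A * B) $$ (xs ! a, ys ! b)) $$ (a, p a)
        = (\<Sum>l\<in>{0..<n}. A $$ (xs ! a, l) * B $$ (l, ys ! p a))"
      using A B xn yn by (simp add: scalar_prod_def)
  qed
  also have "\<dots> = (\<Sum>p\<in>?P. \<Sum>f\<in>?F. signof p * (\<Prod>a = 0..<k. A $$ (xs ! a, f a) * B $$ (f a, ys ! p a)))"
    by (simp add: prod_sum_PiE sum_distrib_left)
  also have "\<dots> = (\<Sum>f\<in>?F. \<Sum>p\<in>?P. signof p * (\<Prod>a = 0..<k. A $$ (xs ! a, f a) * B $$ (f a, ys ! p a)))"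
    by (rule sum.swap)
  also have "\<dots> = (\<Sum>f\<in>?F. H f)"
    by (simp add: H_def G_def' prod.distrib sum_distrib_left mult_ac)
  also have "\<dots> = (\<Sum>f\<in>{f \<in> ?F. inj_on f {0..<k}}. H f)"
  proof (rule sum.mono_neutral_right)
    show "finite ?F" by (simp add: finite_PiE)
    show "\<forall>f\<in>?F - {f \<in> ?F. inj_on f {0..<k}}. H f = 0"
    proof
      fix f assume "f \<in> ?F - {f \<in> ?F. inj_on f {0..<k}}"
      then obtain i j where ij: "i < k" "j < k" "i \<noteq> j" "f i = f j" by (auto simp: inj_on_def)
      have "G f = 0" unfolding G_def
        by (rule det_identical_rows[of _ k i j]) (use ij in \<open>auto intro!: eq_vecI\<close>)
      thus "H f = 0" by (simp add: H_def)
    qed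
  qed auto
  also have "\<dots> = (\<Sum>(zs, \<pi>)\<in>?L \<times> ?P. H (restrict (\<lambda>a. zs ! \<pi> a) {0..<k}))"
    using sum.reindex_bij_betw[OF bij_betw_increasing_permutation[of k n], of H]
    by (simp add: case_prod_beta)
  also have "\<dots> = (\<Sum>zs\<in>?L. \<Sum>\<pi>\<in>?P. H (restrict (\<lambda>a. zs ! \<pi> a) {0..<k}))"
    by (simp add: sum.cartesian_product)
  also have "\<dots> = (\<Sum>zs\<in>?L. minor k A xs zs * minor k B zs ys)"
  proof (rule sum.cong[OF refl])
    fix zs assume zs: "zs \<in> ?L"
    have "H (restrict (\<lambda>a. zs ! \<pi> a) {0..<k})
        = signof \<pi> * (\<Prod>a = 0..<k. A $$ (xs ! a, zs ! \<pi> a)) * minor k B zs ys"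
      if "\<pi> \<in> ?P" for \<pi>
    proof -
      let ?B = "mat k k (\<lambda>(a, b). B $$ (zs ! a, ys ! b))"
      have pi: "\<pi> a < k" if "a < k" for a
        using \<open>\<pi> \<in> ?P\<close> that permutes_in_image[of \<pi> "{0..<k}" a] by auto
      have "G (restrict (\<lambda>a. zs ! \<pi> a) {0..<k}) = det (mat k k (\<lambda>(a, b). ?B $$ (\<pi> a, b)))"
        unfolding G_def by (intro arg_cong[of _ _ det] eq_matI) (auto simp: pi)
      also have "\<dots> = signof \<pi> * minor k B zs ys"
        unfolding minor_def using that by (intro det_permute_rows) auto
      finally show ?thesis by (simp add: H_def)
    qed
    hence "(\<Sum>\<pi>\<in>?P. H (restrict (\<lambda>a. zs ! \<pi> a) {0..<k}))
        = (\<Sum>\<pi>\<in>?P. signof \<pi> * (\<Prod>a = 0..<k. A $$ (xs ! a, zs ! \<pi> a))) * minor k B zs ys"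
      by (simp add: sum_distrib_right)
    also have "(\<Sum>\<pi>\<in>?P. signof \<pi> * (\<Prod>a = 0..<k. A $$ (xs ! a, zs ! \<pi> a)))
        = (\<Sum>p\<in>?P. signof p * (\<Prod>a = 0..<k. mat k k (\<lambda>(a, b). A $$ (xs ! a, zs ! b)) $$ (a, p a)))"
      by (intro sum.cong prod.cong arg_cong2[of _ _ _ _ "(*)"]) (auto dest!: permutes_in_image)
    also have "\<dots> = minor k A xs zs"
      unfolding minor_def by (rule det_def'[symmetric]) simp
    finally show "(\<Sum>\<pi>\<in>?P. H (restrict (\<lambda>a. zs ! \<pi> a) {0..<k})) = minor k A xs zs * minor k B zs ys" .
  qed
  also have "\<dots> = (\<Sum>zs\<leftarrow>increasing_lists n k. minor k A xs zs * minor k B zs ys)"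
    by (simp add: sum_list_distinct_conv_sum_set distinct_increasing_lists)
  finally show ?thesis .
qed

lemma compound_mult:
  assumes A: "A \<in> carrier_mat n n" and B: "B \<in> carrier_mat n n"
  shows "compound n k (A * B) = compound n k A * compound n k B"
proof (rule eq_matI)
  let ?L = "increasing_lists n k"
  fix i j assume "i < dim_row (compound n k A * compound n k B)" "j < dim_col (compound n k A * compound n k B)"
  hence ij: "i < length ?L" "j < length ?L" by (auto simp: compound_def Let_def)
  note Li = increasing_listsD[OF nth_mem[OF ij(1)]]
  note Lj = increasing_listsD[OF nth_mem[OF ij(2)]]
  have "compound n k (A * B) $$ (i, j)
      = (\<Sum>zs\<leftarrow>?L. minor k A (?L ! i) zs * minor k B zs (?L ! j))"
    using ij cauchy_binet[OF A B Li(1,2) Lj(1,2)] by (simp add: compound_def Let_def)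
  also have "\<dots> = (\<Sum>l = 0..<length ?L. minor k A (?L ! i) (?L ! l) * minor k B (?L ! l) (?L ! j))"
    by (simp add: sum_list_sum_nth)
  also have "\<dots> = (compound n k A * compound n k B) $$ (i, j)"
    using ij by (simp add: compound_def Let_def scalar_prod_def)
  finally show "compound n k (A * B) $$ (i, j) = (compound n k A * compound n k B) $$ (i, j)" .
qed (simp_all add: compound_def Let_def)

lemma compound_adjoint:
  assumes A: "A \<in> carrier_mat n n"
  shows "compound n k (mat_adjoint A) = mat_adjoint (compound n k A)"
proof (rule eq_matI)
  let ?L = "increasing_lists n k"
  note d = carrier_matD[OF mat_adjoint_carrier[OF compound_carrier[of n k A]]]
  fix i j assume "i < dim_row (mat_adjoint (compound n k A))" "j < dim_col (mat_adjoint (compound n k A))"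
  hence ij: "i < length ?L" "j < length ?L" by (simp_all add: d)
  note Li = increasing_listsD[OF nth_mem[OF ij(1)]]
  note Lj = increasing_listsD[OF nth_mem[OF ij(2)]]
  let ?N = "mat k k (\<lambda>(a, b). A $$ (?L ! j ! a, ?L ! i ! b))"
  interpret c: comm_ring_hom cnj by unfold_locales auto
  have nth: "?L ! i ! a < n" "?L ! j ! a < n" if "a < k" for a
    using that Li(1,2) Lj(1,2) by (auto intro: nth_less_bound)
  have "mat k k (\<lambda>(a, b). mat_adjoint A $$ (?L ! i ! a, ?L ! j ! b)) = transpose_mat (map_mat cnj ?N)"
    by (intro eq_matI) (use A nth in \<open>auto simp: mat_adjoint_index\<close>)
  hence "minor k (mat_adjoint A) (?L ! i) (?L ! j) = cnj (minor k A (?L ! j) (?L ! i))"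
    unfolding minor_def by (simp add: det_transpose[of _ k] flip: c.hom_det)
  thus "compound n k (mat_adjoint A) $$ (i, j) = mat_adjoint (compound n k A) $$ (i, j)"
    using ij by (simp add: mat_adjoint_index compound_def Let_def)
qed (use carrier_matD[OF mat_adjoint_carrier[OF compound_carrier[of n k A]]] in \<open>simp_all add: compound_def Let_def\<close>)

lemma det_zero_row:
  assumes "A \<in> carrier_mat k k" "a < k" "\<And>b. b < k \<Longrightarrow> A $$ (a, b) = (0 :: complex)"
  shows "det A = 0"
  unfolding det_def'[OF assms(1)]
proof (intro sum.neutral ballI)
  fix p assume "p \<in> {p. p permutes {0..<k}}"
  hence "p a < k" using assms(2) permutes_in_image[of p "{0..<k}" a] by auto
  hence "(\<Prod>i = 0..<k. A $$ (i, p i)) = 0"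
    using assms by (intro prod_zero bexI[of _ a]) auto
  thus "signof p * (\<Prod>i = 0..<k. A $$ (i, p i)) = 0" by simp
qed

lemma compound_mat_diag:
  "compound n k (mat_diag n d)
   = mat_diag (compound_dim n k) (\<lambda>i. \<Prod>a<k. d (increasing_lists n k ! i ! a))"
proof (rule eq_matI)
  let ?L = "increasing_lists n k"
  let ?D = "mat_diag (compound_dim n k) (\<lambda>i. \<Prod>a<k. d (?L ! i ! a))"
  fix i j assume "i < dim_row ?D" "j < dim_col ?D"
  hence ij: "i < length ?L" "j < length ?L" by (auto simp: mat_diag_def)
  note Li = increasing_listsD[OF nth_mem[OF ij(1)]]
  note Lj = increasing_listsD[OF nth_mem[OF ij(2)]]
  let ?N = "mat k k (\<lambda>(a, b). mat_diag n d $$ (?L ! i ! a, ?L ! j ! b))"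
  have nth: "?L ! i ! a < n" "?L ! j ! a < n" if "a < k" for a
    using that Li(1,2) Lj(1,2) by (auto intro: nth_less_bound)
  \<comment> \<open>If \<open>i \<noteq> j\<close>, some index selected by \<open>i\<close> is not selected by \<open>j\<close>: the minor has a zero row.\<close>
  have "minor k (mat_diag n d) (?L ! i) (?L ! j) = (if i = j then \<Prod>a<k. d (?L ! j ! a) else 0)"
  proof (cases "i = j")
    case True
    have "?N = mat_diag k (\<lambda>a. d (?L ! j ! a))"
      by (intro eq_matI) (use True Lj(1,4) nth in \<open>auto simp: mat_diag_def nth_eq_iff_index_eq\<close>)
    moreover have "det (mat_diag k (\<lambda>a. d (?L ! j ! a))) = (\<Prod>a<k. d (?L ! j ! a))"
      by (subst det_upper_triangular[of _ k])
        (auto simp: mat_diag_def prod_list_diag_prod atLeast0LessThan)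
    ultimately show ?thesis using True by (simp add: minor_def)
  next
    case False
    have "set (?L ! i) \<noteq> set (?L ! j)"
      using False ij distinct_increasing_lists[of n k] Li(3) Lj(3)
      by (metis nth_eq_iff_index_eq strict_sorted_equal)
    moreover have "card (set (?L ! i)) = card (set (?L ! j))"
      using Li Lj by (simp add: distinct_card)
    ultimately have "\<not> set (?L ! i) \<subseteq> set (?L ! j)" by (metis card_subset_eq List.finite_set)
    then obtain a where a: "a < k" "?L ! i ! a \<notin> set (?L ! j)"
      using Li(1) by (auto simp: set_conv_nth)
    have "minor k (mat_diag n d) (?L ! i) (?L ! j) = 0"
      unfolding minor_def
    proof (rule det_zero_row[OF _ a(1)])
      fix b assume b: "b < k"
      hence "?L ! i ! a \<noteq> ?L ! j ! b" using a Lj(1) by auto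
      thus "?N $$ (a, b) = 0" using a b nth by (simp add: mat_diag_def)
    qed simp
    thus ?thesis using False by simp
  qed
  thus "compound n k (mat_diag n d) $$ (i, j) = ?D $$ (i, j)"
    using ij by (simp add: compound_def Let_def mat_diag_def)
qed (auto simp: compound_def Let_def mat_diag_def)

lemma compound_one: "compound n k (1\<^sub>m n) = 1\<^sub>m (compound_dim n k)"
  using compound_mat_diag[of n k "\<lambda>_. 1"] by simp

lemma powr_prod:
  "(\<And>a. a \<in> S \<Longrightarrow> 0 \<le> f a) \<Longrightarrow> (\<Prod>a\<in>S. f a powr p) = (\<Prod>a\<in>S. f a :: real) powr p"
  by (induction S rule: infinite_finite_induct) (auto simp: powr_mult prod_nonneg)

lemma index_le_nth_increasing:
  assumes "sorted_wrt (<) xs" "a < length xs"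
  shows "a \<le> xs ! (a :: nat)"
  using assms(2)
proof (induction a)
  case (Suc a)
  hence "xs ! a < xs ! Suc a" using assms(1) by (intro sorted_wrt_nth_less) auto
  thus ?case using Suc by simp
qed simp

lemma (in square_mats) diagonalizes_compound:
  assumes "diagonalizes U d A"
  shows "square_mats.diagonalizes (compound_dim n k) (compound n k U)
    (\<lambda>i. \<Prod>a<k. d (increasing_lists n k ! i ! a)) (compound n k A)"
proof -
  interpret N: square_mats "compound_dim n k" .
  have U: "unitary n U" and A: "A = U * rdiag n d * mat_adjoint U"
    using assms by (auto simp: diagonalizes_def)
  have "mat_adjoint (compound n k U) * compound n k U = compound n k (mat_adjoint U * U)"
    using U by (simp add: compound_mult[of _ n] compound_adjoint[of _ n] del: unitary_left)
  hence "unitary (compound_dim n k) (compound n k U)"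
    unfolding unitary_def using U by (simp add: compound_one)
  moreover have "compound n k A = compound n k U * compound n k (rdiag n d) * mat_adjoint (compound n k U)"
    unfolding A using U by (simp add: compound_mult[of _ n] compound_adjoint[of _ n] del: assoc_mult_mat)
  ultimately show ?thesis
    by (simp add: N.diagonalizes_def compound_mat_diag)
qed

context square_mats
begin

lemma compound_psd:
  assumes "psd n A" shows "psd (compound_dim n k) (compound n k A)"
proof -
  interpret N: square_mats "compound_dim n k" .
  obtain U d where U: "diagonalizes U d A" "\<And>i. 0 \<le> d i" using psd_diagonalization[OF assms] by blast
  show ?thesis
    using N.psd_diagonalizes_iff[OF diagonalizes_compound[OF U(1)]] U(2) by (simp add: prod_nonneg)
qed

lemma compound_powm:
  assumes "psd n A" shows "compound n k (A powm p) = compound n k A powm p"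
proof -
  interpret N: square_mats "compound_dim n k" .
  obtain U d where U: "diagonalizes U d A" "\<And>i. 0 \<le> d i" using psd_diagonalization[OF assms] by blast
  show ?thesis
    using diagonalizes_compound[OF diagonalizes_powm[OF U(1), of p], of k]
      N.powm_diagonalizes[OF diagonalizes_compound[OF U(1), of k], of p] U(2)
    by (simp add: N.diagonalizes_def powr_prod)
qed

text \<open>Expressing definiteness by \<open>B powm 0 = 1\<close> makes it visible to the compound.\<close>

lemma pd_iff_powm_0: "pd n A \<longleftrightarrow> psd n A \<and> A powm 0 = 1\<^sub>m n"
proof
  assume "pd n A" thus "psd n A \<and> A powm 0 = 1\<^sub>m n" by (simp add: pd_imp_psd pd_powm_0)
next
  assume A: "psd n A \<and> A powm 0 = 1\<^sub>m n"
  have "0 < qf A v" if v: "v \<in> V" "v \<noteq> 0\<^sub>v n" for v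
  proof (rule ccontr)
    assume "\<not> 0 < qf A v"
    hence "A *\<^sub>v v = 0\<^sub>v n" using A v psd_qf[of A v] by (intro psd_qf_eq_0) auto
    moreover have "A powm -1 * A = 1\<^sub>m n" using A powm_add[of A "-1" 1] by simp
    ultimately have "v = 0\<^sub>v n" using vassoc[of "A powm -1" A v] A v by simp
    thus False using v by simp
  qed
  thus "pd n A" using A by (auto simp: pd_iff psd_iff)
qed

lemma compound_pd:
  assumes "pd n B" shows "pd (compound_dim n k) (compound n k B)"
proof -
  interpret N: square_mats "compound_dim n k" .
  have "psd n B" "B powm 0 = 1\<^sub>m n" using assms by (auto simp: pd_iff_powm_0)
  thus ?thesis
    by (simp add: N.pd_iff_powm_0 compound_psd compound_one flip: compound_powm)
qed

lemma P_alpha_psd: "psd n A \<Longrightarrow> psd n B \<Longrightarrow> psd n (P_alpha \<alpha> A B)"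
  by (simp add: P_alpha_def)

lemma Q_alpha_z_psd: "psd n A \<Longrightarrow> psd n B \<Longrightarrow> psd n (Q_alpha_z \<alpha> z A B)"
  by (simp add: Q_alpha_z_def)

lemma compound_sandwich:
  assumes "psd n A" "psd n C"
  shows "compound n k (C powm a * A * C powm a)
       = compound n k C powm a * compound n k A * compound n k C powm a"
  using assms by (simp add: compound_mult[of _ n] compound_powm del: assoc_mult_mat)

lemma compound_P_alpha:
  assumes "psd n A" "psd n B"
  shows "compound n k (P_alpha \<alpha> A B) = P_alpha \<alpha> (compound n k A) (compound n k B)"
  using assms by (simp add: P_alpha_def compound_sandwich compound_powm del: assoc_mult_mat)

lemma compound_Q_alpha_z:
  assumes "psd n A" "psd n B"
  shows "compound n k (Q_alpha_z \<alpha> z A B) = Q_alpha_z \<alpha> z (compound n k A) (compound n k B)"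
  using assms by (simp add: Q_alpha_z_def compound_sandwich compound_powm del: assoc_mult_mat)

section \<open>Scaling\<close>

abbreviation scale :: "real \<Rightarrow> complex mat \<Rightarrow> complex mat" where
  "scale t A \<equiv> complex_of_real t \<cdot>\<^sub>m A"

lemma diagonalizes_scale:
  assumes "diagonalizes U d A"
  shows "diagonalizes U (\<lambda>i. t * d i) (scale t A)"
proof -
  have U: "unitary n U" using assms by (simp add: diagonalizes_def)
  have "rdiag n (\<lambda>i. t * d i) = scale t (rdiag n d)"
    by (intro eq_matI) (auto simp: mat_diag_def)
  thus ?thesis using assms U
    by (simp add: diagonalizes_def mult_smult_distrib[of _ n n _ n] mult_smult_assoc_mat[of _ n n _ n]
        del: assoc_mult_mat)
qed

lemma scale_psd [simp]:
  assumes "psd n A" "0 \<le> t" shows "psd n (scale t A)"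
proof -
  obtain U d where U: "diagonalizes U d A" "\<And>i. 0 \<le> d i" using psd_diagonalization[OF assms(1)] by blast
  show ?thesis using psd_diagonalizes_iff[OF diagonalizes_scale[OF U(1)], of t] U(2) assms(2) by simp
qed

lemma scale_powm:
  assumes "psd n A" "0 < t" shows "scale t A powm p = scale (t powr p) (A powm p)"
proof -
  obtain U d where U: "diagonalizes U d A" "\<And>i. 0 \<le> d i" using psd_diagonalization[OF assms(1)] by blast
  show ?thesis
    using powm_diagonalizes[OF diagonalizes_scale[OF U(1), of t], of p]
      diagonalizes_scale[OF diagonalizes_powm[OF U(1)], of "t powr p" p] U(2) assms(2)
    by (simp add: diagonalizes_def powr_mult)
qed

lemma scale_sandwich:
  assumes "A \<in> M" "C \<in> M" shows "C * scale t A * C = scale t (C * A * C)"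
  using assms by (simp add: mult_smult_distrib[of _ n n _ n] mult_smult_assoc_mat[of _ n n _ n] del: assoc_mult_mat)

lemma P_alpha_scale:
  assumes "psd n A" "psd n B" "0 < t"
  shows "P_alpha \<alpha> (scale t A) B = scale (t powr \<alpha>) (P_alpha \<alpha> A B)"
  using assms by (simp add: P_alpha_def scale_sandwich scale_powm del: assoc_mult_mat)

lemma Q_alpha_z_scale:
  assumes "psd n A" "psd n B" "0 < t" "0 < z"
  shows "Q_alpha_z \<alpha> z (scale t A) B = scale (t powr \<alpha>) (Q_alpha_z \<alpha> z A B)"
  using assms by (simp add: Q_alpha_z_def scale_sandwich scale_powm powr_powr del: assoc_mult_mat)

lemma scale_le_one_iff:
  assumes "diagonalizes U d X" "psd n X" "0 < c"
  shows "scale (1 / c) X \<preceq> 1\<^sub>m n \<longleftrightarrow> (\<forall>i<n. d i \<le> c)"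
proof -
  have "psd n (scale (1 / c) X)" by (rule scale_psd) (use assms in auto)
  from loewner_one_iff[OF diagonalizes_scale[OF assms(1), of "1 / c"] this]
  show ?thesis using assms(3) by (simp add: divide_le_eq del: of_real_divide)
qed

section \<open>Determinants\<close>

lemma det_diagonalizes:
  assumes "diagonalizes U d A"
  shows "det A = complex_of_real (\<Prod>i<n. d i)"
proof -
  have U: "unitary n U" using assms by (simp add: diagonalizes_def)
  have "det A = det (mat_adjoint U) * det U * det (rdiag n d)"
    using assms U by (simp add: diagonalizes_def det_mult[of _ n] del: assoc_mult_mat)
  also have "det (mat_adjoint U) * det U = det (mat_adjoint U * U)"
    using U by (simp only: det_mult[of _ n] unitary_M adjoint_M)
  also have "det (rdiag n d) = (\<Prod>i<n. complex_of_real (d i))"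
    by (subst det_upper_triangular[of _ n])
      (auto simp: mat_diag_def prod_list_diag_prod atLeast0LessThan)
  finally show ?thesis using U by simp
qed

lemma det_psd:
  assumes "psd n A"
  obtains a where "0 \<le> a" "det A = complex_of_real a" "\<And>p. det (A powm p) = complex_of_real (a powr p)"
proof -
  obtain U d where U: "diagonalizes U d A" "\<And>i. 0 \<le> d i" using psd_diagonalization[OF assms] by blast
  show thesis
    by (rule that[of "\<Prod>i<n. d i"])
      (use U(2) in \<open>auto simp: det_diagonalizes[OF U(1)] det_diagonalizes[OF diagonalizes_powm[OF U(1)]]
        powr_prod prod_nonneg\<close>)
qed

lemma det_sandwich_powm:
  assumes A: "psd n A" and C: "psd n C" and a: "0 \<le> a" "det A = complex_of_real a"
    and c: "0 < c" "det C = complex_of_real c"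
  shows "det ((C powm s * A * C powm s) powm t) = complex_of_real ((c powr (2 * s) * a) powr t)"
proof -
  obtain c' where c': "det C = complex_of_real c'" "\<And>p. det (C powm p) = complex_of_real (c' powr p)"
    using det_psd[OF C] by blast
  have "c' = c" using c' c by simp
  obtain x where x: "det (C powm s * A * C powm s) = complex_of_real x"
    "det ((C powm s * A * C powm s) powm t) = complex_of_real (x powr t)"
    using det_psd[of "C powm s * A * C powm s"] A C by auto
  have "complex_of_real x = complex_of_real (c powr s * a * c powr s)"
    unfolding x(1)[symmetric] using A C c'(2)[of s] a \<open>c' = c\<close>
    by (simp add: det_mult[of _ n] del: assoc_mult_mat)
  hence "x = c powr s * a * c powr s" by (simp only: of_real_eq_iff)
  also have "\<dots> = c powr (2 * s) * a" using powr_add[of c s s] 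
    by (simp only: mult_2 mult.assoc mult.commute[of a])
  finally show ?thesis using x(2) by simp
qed

lemma det_P_alpha_eq_det_Q_alpha_z:
  assumes A: "psd n A" and B: "pd n B" and z: "0 < z"
  shows "det (P_alpha \<alpha> A B) = det (Q_alpha_z \<alpha> z A B)"
proof -
  have P: "psd n B" using B by (rule pd_imp_psd)
  obtain a where a: "0 \<le> a" "det A = complex_of_real a" "\<And>p. det (A powm p) = complex_of_real (a powr p)"
    using det_psd[OF A] by blast
  obtain b where b: "0 \<le> b" "det B = complex_of_real b" "\<And>p. det (B powm p) = complex_of_real (b powr p)"
    using det_psd[OF P] by blast
  have "b \<noteq> 0" using b(3)[of 0] pd_powm_0[OF B] by auto
  hence b0: "0 < b" using b by simp
  let ?X = "B powm (-1/2) * A * B powm (-1/2)"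
  have X: "psd n ?X" using A P by simp
  have "det (?X powm \<alpha>) = complex_of_real ((b powr (2 * (-1/2)) * a) powr \<alpha>)"
    by (rule det_sandwich_powm[OF A P a(1,2) b0 b(2)])
  from det_sandwich_powm[OF powm_psd[OF X] P _ this b0 b(2), of "1/2" 1]
  have "det (P_alpha \<alpha> A B) = complex_of_real (b * (b powr - 1 * a) powr \<alpha>)"
    using A P b0 by (simp add: P_alpha_def)
  also have "b * (b powr - 1 * a) powr \<alpha> = b powr (1 - \<alpha>) * a powr \<alpha>"
    using b0 a by (simp add: powr_mult powr_powr powr_diff powr_minus powr_divide field_simps)
  also have "\<dots> = (b powr (2 * ((1 - \<alpha>) / (2 * z))) * a powr (\<alpha> / z)) powr z"
  proof -
    have "2 * ((1 - \<alpha>) / (2 * z)) * z = 1 - \<alpha>" "\<alpha> / z * z = \<alpha>" using z by (simp_all add: field_simps)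
    thus ?thesis by (simp only: powr_mult powr_powr powr_ge_zero)
  qed
  also have "complex_of_real \<dots> = det (Q_alpha_z \<alpha> z A B)"
    unfolding Q_alpha_z_def
    by (rule det_sandwich_powm[OF powm_psd[OF A] P _ a(3) b0 b(2), symmetric]) simp
  finally show ?thesis .
qed

section \<open>Log-majorization\<close>

text \<open>The eigenvalues of the \<open>k\<close>-th compound are the products of \<open>k\<close> eigenvalues at distinct positions.
  All of them are at most the product of the \<open>k\<close> largest, which is itself one of them. Bounds \<open>c\<close>
  strictly above that product suffice, and such \<open>c\<close> are positive even if the product is 0.\<close>

lemma log_maj_compoundI:
  assumes X: "psd n X" and Y: "psd n Y" and det: "det X = det Y"
    and le: "\<And>k c. 0 < c \<Longrightarrow>
      square_mats.loewner (compound_dim n k) (scale (1 / c) (compound n k Y)) (1\<^sub>m (compound_dim n k)) \<Longrightarrow>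
      square_mats.loewner (compound_dim n k) (scale (1 / c) (compound n k X)) (1\<^sub>m (compound_dim n k))"
  shows "log_maj n X Y"
proof -
  define x where "x = (!) (eigvals_desc X)"
  define y where "y = (!) (eigvals_desc Y)"
  obtain U where U: "diagonalizes U x X"
    unfolding x_def using diagonalizes_eigvals_desc[of X] X psd_adjoint by auto
  obtain W where W: "diagonalizes W y Y"
    unfolding y_def using diagonalizes_eigvals_desc[of Y] Y psd_adjoint by auto
  have y0: "0 \<le> y i" if "i < n" for i using psd_diagonalizes_iff[OF W] Y that by blast
  have ymono: "y j \<le> y i" if "i \<le> j" "j < n" for i j
    using sorted_wrt_nth_less[OF eigvals_desc_sorted[of Y], of i j] length_eigvals_desc[of Y n] Y that
    unfolding y_def by (cases "i = j") auto
  have "(\<Prod>i<k. x i) \<le> (\<Prod>i<k. y i)" if k: "k \<le> n" for k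
  proof (rule dense_ge)
    fix c assume c: "(\<Prod>i<k. y i) < c"
    interpret N: square_mats "compound_dim n k" .
    let ?L = "increasing_lists n k"
    have "0 \<le> (\<Prod>i<k. y i)" using y0 k by (intro prod_nonneg) auto
    hence c0: "0 < c" using c by simp
    have "(\<Prod>a<k. y (?L ! i ! a)) \<le> c" if i: "i < length ?L" for i
    proof -
      note Li = increasing_listsD[OF nth_mem[OF i]]
      have "(\<Prod>a<k. y (?L ! i ! a)) \<le> (\<Prod>a<k. y a)"
      proof (rule prod_mono)
        fix a assume "a \<in> {..<k}"
        hence "a \<le> ?L ! i ! a" "?L ! i ! a < n"
          using index_le_nth_increasing[OF Li(3), of a] nth_less_bound[OF Li(2), of a] Li(1) by auto
        thus "0 \<le> y (?L ! i ! a) \<and> y (?L ! i ! a) \<le> y a" using y0 ymono by blast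
      qed
      thus ?thesis using c by simp
    qed
    hence "N.loewner (scale (1 / c) (compound n k Y)) (1\<^sub>m (compound_dim n k))"
      using N.scale_le_one_iff[OF diagonalizes_compound[OF W] compound_psd[OF Y] c0] by blast
    hence "N.loewner (scale (1 / c) (compound n k X)) (1\<^sub>m (compound_dim n k))" by (rule le[OF c0])
    hence bound: "(\<Prod>a<k. x (?L ! i ! a)) \<le> c" if "i < length ?L" for i
      using N.scale_le_one_iff[OF diagonalizes_compound[OF U] compound_psd[OF X] c0] that by blast
    have "[0..<k] \<in> set ?L" using k by (auto simp: set_increasing_lists)
    then obtain i where "i < length ?L" "?L ! i = [0..<k]" by (auto simp: in_set_conv_nth)
    thus "(\<Prod>i<k. x i) \<le> c" using bound[of i] by simp
  qed
  moreover have "(\<Prod>i<n. x i) = (\<Prod>i<n. y i)"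
    using det det_diagonalizes[OF U] det_diagonalizes[OF W] by (simp only: of_real_eq_iff)
  ultimately show ?thesis using X Y by (simp add: log_maj_def x_def y_def)
qed

text \<open>By homogeneity in the first argument, the bound \<open>c\<close> for a compound of \<open>F A B\<close> is the bound 1 for
  \<open>F (t A') B'\<close>, where \<open>A'\<close> and \<open>B'\<close> are the compounds of \<open>A\<close> and \<open>B\<close> and \<open>t\<^bsup>\<alpha>\<^esup> = 1 / c\<close>.\<close>

lemma log_maj_of_le_one_comparison:
  fixes F G :: "complex mat \<Rightarrow> complex mat \<Rightarrow> complex mat"
  assumes A: "psd n A" and B: "pd n B" and \<alpha>: "0 < \<alpha>"
    and psd: "psd n (F A B)" "psd n (G A B)" and det: "det (F A B) = det (G A B)"
    and compound: "\<And>k. compound n k (F A B) = F (compound n k A) (compound n k B)"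
      "\<And>k. compound n k (G A B) = G (compound n k A) (compound n k B)"
    and scale: "\<And>m A B t. psd m A \<Longrightarrow> psd m B \<Longrightarrow> 0 < t \<Longrightarrow> F (scale t A) B = scale (t powr \<alpha>) (F A B)"
      "\<And>m A B t. psd m A \<Longrightarrow> psd m B \<Longrightarrow> 0 < t \<Longrightarrow> G (scale t A) B = scale (t powr \<alpha>) (G A B)"
    and le: "\<And>m A B. psd m A \<Longrightarrow> pd m B \<Longrightarrow> square_mats.loewner m (G A B) (1\<^sub>m m)
      \<Longrightarrow> square_mats.loewner m (F A B) (1\<^sub>m m)"
  shows "log_maj n (F A B) (G A B)"
proof (rule log_maj_compoundI[OF psd det])
  fix k and c :: real assume c: "0 < c"
  interpret N: square_mats "compound_dim n k" .
  define t where "t = (1 / c) powr (1 / \<alpha>)"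
  have t: "0 < t" "t powr \<alpha> = 1 / c" using c \<alpha> by (simp_all add: t_def powr_powr)
  note CA = compound_psd[OF A, of k] and CB = compound_pd[OF B, of k]
  note CP = N.pd_imp_psd[OF CB]
  have "scale (1 / c) (compound n k (G A B)) = G (scale t (compound n k A)) (compound n k B)"
    by (simp only: compound scale[OF CA CP t(1)] t(2))
  moreover have "scale (1 / c) (compound n k (F A B)) = F (scale t (compound n k A)) (compound n k B)"
    by (simp only: compound scale[OF CA CP t(1)] t(2))
  moreover assume "N.loewner (scale (1 / c) (compound n k (G A B))) (1\<^sub>m (compound_dim n k))"
  ultimately show "N.loewner (scale (1 / c) (compound n k (F A B))) (1\<^sub>m (compound_dim n k))"
    using le[OF N.scale_psd[OF CA] CB, of t] t(1) by simp
qed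

lemma P_log_maj_Q:
  assumes A: "psd n A" and B: "pd n B" and \<alpha>: "0 < \<alpha>" and z: "0 < z"
    and le: "\<And>m A B. psd m A \<Longrightarrow> pd m B \<Longrightarrow> square_mats.loewner m (Q_alpha_z \<alpha> z A B) (1\<^sub>m m)
      \<Longrightarrow> square_mats.loewner m (P_alpha \<alpha> A B) (1\<^sub>m m)"
  shows "log_maj n (P_alpha \<alpha> A B) (Q_alpha_z \<alpha> z A B)"
proof -
  have P: "psd n B" using B by (rule pd_imp_psd)
  show ?thesis
    by (rule log_maj_of_le_one_comparison[OF A B \<alpha> P_alpha_psd[OF A P] Q_alpha_z_psd[OF A P]
          det_P_alpha_eq_det_Q_alpha_z[OF A B z] compound_P_alpha[OF A P] compound_Q_alpha_z[OF A P]
          square_mats.P_alpha_scale square_mats.Q_alpha_z_scale[OF _ _ _ z] le])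
qed

lemma Q_log_maj_P:
  assumes A: "psd n A" and B: "pd n B" and \<alpha>: "0 < \<alpha>" and z: "0 < z"
    and le: "\<And>m A B. psd m A \<Longrightarrow> pd m B \<Longrightarrow> square_mats.loewner m (P_alpha \<alpha> A B) (1\<^sub>m m)
      \<Longrightarrow> square_mats.loewner m (Q_alpha_z \<alpha> z A B) (1\<^sub>m m)"
  shows "log_maj n (Q_alpha_z \<alpha> z A B) (P_alpha \<alpha> A B)"
proof -
  have P: "psd n B" using B by (rule pd_imp_psd)
  show ?thesis
    by (rule log_maj_of_le_one_comparison[OF A B \<alpha> Q_alpha_z_psd[OF A P] P_alpha_psd[OF A P]
          det_P_alpha_eq_det_Q_alpha_z[OF A B z, symmetric] compound_Q_alpha_z[OF A P] compound_P_alpha[OF A P]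
          square_mats.Q_alpha_z_scale[OF _ _ _ z] square_mats.P_alpha_scale le])
qed

end

theorem theorem1p1:
  fixes n :: nat and A B :: "complex mat"
  assumes "psd n A" and "pd n B"
  shows "(\<forall>\<alpha> z :: real. 0 < \<alpha> \<and> \<alpha> < 1 \<and> 0 < z \<longrightarrow>
            log_maj n (P_alpha \<alpha> A B) (Q_alpha_z \<alpha> z A B)) \<and>
         (\<forall>\<alpha> z :: real. 1 < \<alpha> \<and> 0 < z \<and> z \<le> min (\<alpha> / 2) (\<alpha> - 1) \<longrightarrow>
            log_maj n (P_alpha \<alpha> A B) (Q_alpha_z \<alpha> z A B)) \<and>
         (\<forall>\<alpha> z :: real. 1 < \<alpha> \<and> max (\<alpha> / 2) (\<alpha> - 1) \<le> z \<longrightarrow>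
            log_maj n (Q_alpha_z \<alpha> z A B) (P_alpha \<alpha> A B)) \<and>
         (\<forall>\<alpha> :: real. (0 < \<alpha> \<and> \<alpha> < 1) \<or> 2 \<le> \<alpha> \<longrightarrow>
            log_maj n (P_alpha \<alpha> A B) (Q_alpha \<alpha> A B)) \<and>
         (\<forall>\<alpha> :: real. 1 < \<alpha> \<and> \<alpha> \<le> 2 \<longrightarrow>
            log_maj n (Q_alpha \<alpha> A B) (P_alpha \<alpha> A B))"
proof -
  have 1: "log_maj n (P_alpha \<alpha> A B) (Q_alpha_z \<alpha> z A B)" if "0 < \<alpha>" "\<alpha> < 1" "0 < z" for \<alpha> z
    using that assms by (intro square_mats.P_log_maj_Q square_mats.P_le_one_of_Q_small_alpha) auto
  have 2: "log_maj n (P_alpha \<alpha> A B) (Q_alpha_z \<alpha> z A B)"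
    if "1 < \<alpha>" "0 < z" "z \<le> min (\<alpha> / 2) (\<alpha> - 1)" for \<alpha> z
    using that assms by (intro square_mats.P_log_maj_Q square_mats.P_le_one_of_Q_large_alpha) auto
  have 3: "log_maj n (Q_alpha_z \<alpha> z A B) (P_alpha \<alpha> A B)"
    if "1 < \<alpha>" "max (\<alpha> / 2) (\<alpha> - 1) \<le> z" for \<alpha> z
    using that assms by (intro square_mats.Q_log_maj_P square_mats.Q_le_one_of_P) auto
  show ?thesis
    unfolding Q_alpha_def using 1 2 3 by auto
qed

end
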